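(* Consider the noisy GMM iterates for the quadratic function $f$ with Gaussian gradient noise as described in the context. For a fixed risk parameter $\theta>0$, the infinite-horizon entropic risk $r_{\sigma^2}(\theta)$ is finite if and only if the parameters $(\alpha,\beta,\gamma)$ belong to the $\theta$-feasible set $$\mathcal{F}_\theta=\left\{(\alpha,\beta,\gamma)\in\mathbb{R}_{++}\times\mathbb{R}_+\times\mathbb{R}_+ \;\middle|\; |c_i|<|1-d_i| \text{ and } \theta<2u_i\text{ for } i=1,\dots,d\right\}.$$ Moreover, in this case $\rho(A_Q)<1$ and the finite-horizon entropic risk $r_{k,\sigma^2}(\theta)$ converges to $r_{\sigma^2}(\theta)$ linearly, satisfying $$|r_{k,\sigma^2}(\theta)-r_{\sigma^2}(\theta)|\le \mathcal{O}\left(C_k^2\rho(A_Q)^{2(k-1)}+C_k^4\rho(A_Q)^{4(k-1)}\right)\qquad (k\to\infty),$$ where $\mathcal{O}(\cdot)$ hides constants (independent of $k$) that depend on the initialization $z_0$.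
   Context: Let $0<\mu<L$ and let $f(x)=\frac12x^\top Qx+p^\top x+r$ on $\mathbb{R}^d$, where $Q$ is a symmetric matrix with eigenvalues $0<\mu=\lambda_1(Q)\le\dots\le\lambda_d(Q)=L$, $p\in\mathbb{R}^d$, $r\in\mathbb{R}$; $x_*$ is the unique minimizer of $f$. The noisy generalized momentum method (GMM) with parameters $\alpha>0$, $\beta,\gamma\ge0$ and deterministic initialization $x_0,x_{-1}\in\mathbb{R}^d$ is $$x_{k+1}=(1+\beta)x_k-\beta x_{k-1}-\alpha\left(\nabla f(y_k)+w_{k+1}\right),\qquad y_k=(1+\gamma)x_k-\gamma x_{k-1},\qquad k\ge 0.$$ Noise assumption: for each $k$, $w_{k+1}\sim\mathcal{N}(0,\sigma^2I_d)$ for some $\sigma>0$, and $w_{k+1}$ is independent of the $\sigma$-algebra $\mathcal{F}_k$ generated by $x_0,\dots,x_k$. Put $z_k=[x_k^\top,x_{k-1}^\top]^\top$, $z_*=[x_*^\top,x_*^\top]^\top$; then $z_{k+1}-z_*=A_Q(z_k-z_* )+Bw_{k+1}$ with $A_Q=\begin{bmatrix}(1+\beta)I_d-\alpha(1+\gamma)Q & -(\beta I_d-\alpha\gamma Q)\\ I_d&0_d\end{bmatrix}$, $B=\begin{bmatrix}-\alpha I_d\\0_d\end{bmatrix}$. $\rho(A_Q)$ is the spectral radius of $A_Q$. For $i=1,\dots,d$: $c_i=(1+\beta)-\alpha(1+\gamma)\lambda_i(Q)$, $d_i=-(\beta-\alpha\gamma\lambda_i(Q))$, $$u_i=\frac{(1+d_i)\left[(1-d_i)^2-c_i^2\right]}{\lambda_i(Q)(1-d_i)\alpha^2}.$$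 $C_k=\max_iC_k^{(i)}$ where $C_k^{(i)}=\frac{|c_i^2+2d_i+2|\rho_i}{\sqrt{|c_i^2+4d_i|}}$ if $c_i^2+4d_i\ne0$ and $C_k^{(i)}=(\frac{c_i^2}{4}+2)\sqrt{2\rho_i^2+k^2}$ if $c_i^2+4d_i=0$, with $\rho_i=\frac12|c_i|+\frac12\sqrt{c_i^2+4d_i}$ if $c_i^2+4d_i\ge0$ and $\rho_i=\sqrt{|d_i|}$ otherwise. Entropic risks ($\theta>0$): finite horizon $r_{k,\sigma^2}(\theta)=\frac{2\sigma^2}{\theta}\log\mathbb{E}\left[e^{\frac{\theta}{2\sigma^2}(f(x_k)-f(x_* ))}\right]$ (possibly $+\infty$), infinite horizon $r_{\sigma^2}(\theta)=\limsup_{k\to\infty}r_{k,\sigma^2}(\theta)$. $g(k)=\mathcal{O}(h(k))$ means there exist $K>0$, $k_0\ge0$ with $g(k)\le K h(k)$ for all $k>k_0$. $\mathbb{R}_+$ and $\mathbb{R}_{++}$ are the non-negative and the positive reals. *)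

theory Defs
  imports "HOL-Probability.Probability"
begin

definition quadratic :: "real^'d^'d \<Rightarrow> real^'d \<Rightarrow> real \<Rightarrow> real^'d \<Rightarrow> real" where
  "quadratic Q p r x = 1/2 * (x \<bullet> (Q *v x)) + p \<bullet> x + r"

definition gradient :: "('a::real_inner \<Rightarrow> real) \<Rightarrow> 'a \<Rightarrow> 'a" where
  "gradient f x = (THE g. GDERIV f x :> g)"

(* The eigenvalues are counted with multiplicity: the second conjunct says that
   the characteristic polynomial of Q is the product of the factors x - lam i. *)
definition ordered_eigenvalues :: "real^'d^'d \<Rightarrow> (nat \<Rightarrow> real) \<Rightarrow> bool" where
  "ordered_eigenvalues Q lam \<longleftrightarrow>
     mono_on {1..CARD('d)} lam \<and>
     (\<forall>x. det (mat x - Q) = (\<Prod>i\<in>{1..CARD('d)}. x - lam i))"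

(* The state after k steps is the pair (x_k, x_{k-1}); the step from k to k+1
   uses the noise vector w (Suc k), so w 0 is never used. *)
primrec gmm_state ::
  "('a::real_inner \<Rightarrow> real) \<Rightarrow> real \<Rightarrow> real \<Rightarrow> real \<Rightarrow> 'a \<Rightarrow> 'a \<Rightarrow> (nat \<Rightarrow> 'a) \<Rightarrow> nat \<Rightarrow> 'a \<times> 'a" where
  "gmm_state f \<alpha> \<beta> \<gamma> x0 xm1 w 0 = (x0, xm1)"
| "gmm_state f \<alpha> \<beta> \<gamma> x0 xm1 w (Suc k) =
     (let (x, x') = gmm_state f \<alpha> \<beta> \<gamma> x0 xm1 w k;
          y = (1 + \<gamma>) *\<^sub>R x - \<gamma> *\<^sub>R x'
      in ((1 + \<beta>) *\<^sub>R x - \<beta> *\<^sub>R x' - \<alpha> *\<^sub>R (gradient f y + w (Suc k)), x))"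

definition gmm ::
  "('a::real_inner \<Rightarrow> real) \<Rightarrow> real \<Rightarrow> real \<Rightarrow> real \<Rightarrow> 'a \<Rightarrow> 'a \<Rightarrow> (nat \<Rightarrow> 'a) \<Rightarrow> nat \<Rightarrow> 'a" where
  "gmm f \<alpha> \<beta> \<gamma> x0 xm1 w k = fst (gmm_state f \<alpha> \<beta> \<gamma> x0 xm1 w k)"

definition block_matrix ::
  "'a^'n^'m \<Rightarrow> 'a^'k^'m \<Rightarrow> 'a^'n^'l \<Rightarrow> 'a^'k^'l \<Rightarrow> 'a^('n + 'k)^('m + 'l)" where
  "block_matrix A B C D = (\<chi> i j.
     case i of
       Inl a \<Rightarrow> (case j of Inl b \<Rightarrow> A $ a $ b | Inr b \<Rightarrow> B $ a $ b)
     | Inr a \<Rightarrow> (case j of Inl b \<Rightarrow> C $ a $ b | Inr b \<Rightarrow> D $ a $ b))"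

definition gmm_matrix ::
  "real^'d^'d \<Rightarrow> real \<Rightarrow> real \<Rightarrow> real \<Rightarrow> real^('d + 'd)^('d + 'd)" where
  "gmm_matrix Q \<alpha> \<beta> \<gamma> =
     block_matrix (mat (1 + \<beta>) - (\<alpha> * (1 + \<gamma>)) *\<^sub>R Q) (- (mat \<beta> - (\<alpha> * \<gamma>) *\<^sub>R Q))
                  (mat 1)                           (mat 0)"

definition complex_spectrum :: "real^'n^'n \<Rightarrow> complex set" where
  "complex_spectrum A =
     {z. \<exists>v. v \<noteq> 0 \<and> (\<chi> i j. complex_of_real (A $ i $ j)) *v v = z *s v}"

definition spectral_radius :: "real^'n^'n \<Rightarrow> real" where
  "spectral_radius A = Max (cmod ` complex_spectrum A)"

definition isotropic_gaussian_density :: "real \<Rightarrow> real^'d \<Rightarrow> real" where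
  "isotropic_gaussian_density \<sigma> x =
     exp (- (norm x)\<^sup>2 / (2 * \<sigma>\<^sup>2)) / sqrt (2 * pi * \<sigma>\<^sup>2) ^ CARD('d)"

definition generated_events ::
  "'w measure \<Rightarrow> ('i \<Rightarrow> 'w \<Rightarrow> 'a::topological_space) \<Rightarrow> 'i set \<Rightarrow> 'w set set" where
  "generated_events M X I =
     sigma_sets (space M) (\<Union>i\<in>I. {X i -` A \<inter> space M | A. A \<in> sets borel})"

definition gaussian_noise ::
  "'w measure \<Rightarrow> real \<Rightarrow> (nat \<Rightarrow> 'w \<Rightarrow> real^'d) \<Rightarrow> (nat \<Rightarrow> 'w \<Rightarrow> real^'d) \<Rightarrow> bool" where
  "gaussian_noise M \<sigma> X w \<longleftrightarrow>
     (\<forall>k. distributed M lborel (w (Suc k)) (\<lambda>x. ennreal (isotropic_gaussian_density \<sigma> x)) \<and>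
          prob_space.indep_set M (generated_events M X {..k}) (generated_events M w {Suc k}))"

definition ln_ennreal :: "ennreal \<Rightarrow> ereal" where
  "ln_ennreal x = (if x = \<infinity> then \<infinity> else if x = 0 then - \<infinity> else ereal (ln (enn2real x)))"

(* The integrand is positive, so its expectation always exists in [0, \<infinity>]. *)
definition entropic_risk :: "'w measure \<Rightarrow> real \<Rightarrow> real \<Rightarrow> ('w \<Rightarrow> real) \<Rightarrow> ereal" where
  "entropic_risk M \<sigma> \<theta> Y =
     ereal (2 * \<sigma>\<^sup>2 / \<theta>) * ln_ennreal (\<integral>\<^sup>+\<omega>. ennreal (exp (\<theta> / (2 * \<sigma>\<^sup>2) * Y \<omega>)) \<partial>M)"

definition gmm_c :: "real \<Rightarrow> real \<Rightarrow> real \<Rightarrow> real \<Rightarrow> real" where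
  "gmm_c \<alpha> \<beta> \<gamma> l = (1 + \<beta>) - \<alpha> * (1 + \<gamma>) * l"

definition gmm_d :: "real \<Rightarrow> real \<Rightarrow> real \<Rightarrow> real \<Rightarrow> real" where
  "gmm_d \<alpha> \<beta> \<gamma> l = - (\<beta> - \<alpha> * \<gamma> * l)"

(* Division by zero is harmless: for l \<noteq> 0 and \<alpha> > 0 the denominator vanishes
   only if d = 1, and feasible_set then fails by its first condition. *)
definition gmm_u :: "real \<Rightarrow> real \<Rightarrow> real \<Rightarrow> real \<Rightarrow> real" where
  "gmm_u \<alpha> \<beta> \<gamma> l =
     (let c = gmm_c \<alpha> \<beta> \<gamma> l; d = gmm_d \<alpha> \<beta> \<gamma> l
      in (1 + d) * ((1 - d)\<^sup>2 - c\<^sup>2) / (l * (1 - d) * \<alpha>\<^sup>2))"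

definition feasible_set :: "(nat \<Rightarrow> real) \<Rightarrow> nat \<Rightarrow> real \<Rightarrow> (real \<times> real \<times> real) set" where
  "feasible_set lam n \<theta> =
     {(\<alpha>, \<beta>, \<gamma>). \<alpha> > 0 \<and> \<beta> \<ge> 0 \<and> \<gamma> \<ge> 0 \<and>
        (\<forall>i\<in>{1..n}. \<bar>gmm_c \<alpha> \<beta> \<gamma> (lam i)\<bar> < \<bar>1 - gmm_d \<alpha> \<beta> \<gamma> (lam i)\<bar> \<and>
                    \<theta> < 2 * gmm_u \<alpha> \<beta> \<gamma> (lam i))}"

definition rate_rho :: "real \<Rightarrow> real \<Rightarrow> real" where
  "rate_rho c d =
     (if c\<^sup>2 + 4 * d \<ge> 0 then 1/2 * \<bar>c\<bar> + 1/2 * sqrt (c\<^sup>2 + 4 * d) else sqrt \<bar>d\<bar>)"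

definition rate_C :: "real \<Rightarrow> real \<Rightarrow> nat \<Rightarrow> real" where
  "rate_C c d k =
     (if c\<^sup>2 + 4 * d \<noteq> 0
      then \<bar>c\<^sup>2 + 2 * d + 2\<bar> * rate_rho c d / sqrt \<bar>c\<^sup>2 + 4 * d\<bar>
      else (c\<^sup>2 / 4 + 2) * sqrt (2 * (rate_rho c d)\<^sup>2 + (real k)\<^sup>2))"

definition gmm_C :: "(nat \<Rightarrow> real) \<Rightarrow> nat \<Rightarrow> real \<Rightarrow> real \<Rightarrow> real \<Rightarrow> nat \<Rightarrow> real" where
  "gmm_C lam n \<alpha> \<beta> \<gamma> k =
     Max ((\<lambda>i. rate_C (gmm_c \<alpha> \<beta> \<gamma> (lam i)) (gmm_d \<alpha> \<beta> \<gamma> (lam i)) k) ` {1..n})"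

definition big_O :: "(nat \<Rightarrow> ereal) \<Rightarrow> (nat \<Rightarrow> real) \<Rightarrow> bool" where
  "big_O g h \<longleftrightarrow> (\<exists>K>0. \<exists>k0. \<forall>k>k0. g k \<le> ereal (K * h k))"

(* For finite l, the second conjunct forces X k to be finite for all large k. *)
definition converges_linearly :: "(nat \<Rightarrow> ereal) \<Rightarrow> ereal \<Rightarrow> bool" where
  "converges_linearly X l \<longleftrightarrow>
     X \<longlonglongrightarrow> l \<and> (\<exists>q. 0 < q \<and> q < 1 \<and> big_O (\<lambda>k. \<bar>X k - l\<bar>) (\<lambda>k. q ^ k))"

end

theory Submission
  imports Defs
begin

text \<open>
  An orthonormal eigenbasis of \<open>Q\<close> decouples the iteration. In these coordinates the noise is again
  isotropic, and each coordinate \<open>s\<close> of \<open>x\<^sub>k - x\<^sub>*\<close> follows the scalar recursion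
  \<open>s\<^sub>k\<^sub>+\<^sub>1 = c s\<^sub>k + d s\<^sub>k\<^sub>-\<^sub>1 - \<alpha> n\<^sub>k\<^sub>+\<^sub>1\<close>. Let \<open>h\<close> be its impulse response, \<open>h\<^sub>0 = 0\<close>, \<open>h\<^sub>1 = 1\<close>,
  \<open>h\<^sub>n\<^sub>+\<^sub>2 = c h\<^sub>n\<^sub>+\<^sub>1 + d h\<^sub>n\<close>. Then \<open>s\<^sub>k\<close> is Gaussian with mean \<open>m\<^sub>k = h\<^sub>k\<^sub>+\<^sub>1 s\<^sub>0 + d h\<^sub>k s\<^sub>-\<^sub>1\<close> and variance
  \<open>\<alpha>\<^sup>2 \<sigma>\<^sup>2 T\<^sub>k\<close>, where \<open>T\<^sub>k = h\<^sub>1\<^sup>2 + \<dots> + h\<^sub>k\<^sup>2\<close>, and the coordinates are independent. The objective gap is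
  a weighted sum of the squares of the coordinates, so its exponential moment is a product of
  explicit Gaussian factors (\<open>exponential_moment\<close>); the factor of the eigenvalue \<open>l\<close> is finite
  exactly when \<open>\<kappa> T\<^sub>k < 1\<close> with \<open>\<kappa> = \<theta> l \<alpha>\<^sup>2 / 2\<close>.

  Since \<open>T\<^sub>k\<close> increases with \<open>k\<close> and every factor is at least one, a finite limit superior of the
  risks keeps \<open>\<kappa> T\<^sub>k\<close> away from one. Conversely the risks converge if \<open>h\<close> is square summable with sum
  \<open>S\<close> and \<open>\<kappa> S < 1\<close>. It remains to see that this is feasibility. Square summability is equivalent to
  \<open>\<bar>d\<bar> < 1\<close> and \<open>\<bar>c\<bar> < 1 - d\<close>, and squaring the recursion and summing gives
  \<open>S (1 + d) ((1 - d)\<^sup>2 - c\<^sup>2) = 1 - d\<close> (\<open>impulse_energy\<close>), so that \<open>u = 1 / (l \<alpha>\<^sup>2 S)\<close> and \<open>\<kappa> S < 1\<close>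
  says \<open>\<theta> < 2 u\<close> (\<open>gmm_mode_feasible_iff\<close>).

  For the rate, the distance of the risk from its limit is controlled by \<open>m\<^sub>k\<^sup>2 + (S - T\<^sub>k)\<close>, hence by
  \<open>h\<^sub>k\<^sup>2 + h\<^sub>k\<^sub>+\<^sub>1\<^sup>2\<close>: for the tail \<open>S - T\<^sub>k\<close> this is the addition formula of \<open>h\<close> (\<open>impulse_tail\<close>). The
  closed form of \<open>h\<close> in terms of the characteristic roots bounds \<open>\<bar>h\<^sub>k\<bar>\<close> by a multiple of
  \<open>C\<^sub>k \<rho>\<^sup>k\<^sup>-\<^sup>1\<close> (\<open>impulse_decay\<close>), and the spectral radius of the momentum matrix is the largest modulus
  of a characteristic root over all modes (\<open>spectral_radius_gmm_matrix\<close>).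
\<close>

section \<open>Diagonalization of symmetric matrices\<close>

lemma linear_dominated_by_square:
  fixes a b :: real
  assumes "\<And>t. 2 * t * a \<le> t\<^sup>2 * b"
  shows "a = 0"
proof (rule ccontr)
  assume "a \<noteq> 0"
  define s where "s = \<bar>b\<bar> + 1"
  have s: "s > 0" "b < s" unfolding s_def by auto
  have "2 * (a / s) * a \<le> (a / s)\<^sup>2 * b" by (rule assms)
  hence "2 * a\<^sup>2 * s \<le> a\<^sup>2 * b" using s by (simp add: field_simps power2_eq_square)
  hence "2 * s \<le> b" using \<open>a \<noteq> 0\<close> by (simp add: mult.assoc)
  thus False using s by simp
qed

text \<open>The quadratic form of \<open>T\<close> attains its maximum \<open>e\<close> on the unit sphere of \<open>S\<close> at some \<open>x\<close>. Moving
  from \<open>x\<close> in the direction of the residual \<open>T x - e x\<close>, which lies in \<open>S\<close>, would increase the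
  quotient to first order unless the residual vanishes.\<close>
lemma selfadjoint_eigenvector_exists:
  fixes T :: "'a::euclidean_space \<Rightarrow> 'a"
  assumes lin: "linear T" and sa: "\<And>x y. T x \<bullet> y = x \<bullet> T y"
    and S: "subspace S" "S \<noteq> {0}" "T ` S \<subseteq> S"
  obtains x e where "x \<in> S" "norm x = 1" "T x = e *\<^sub>R x"
proof -
  define K where "K = S \<inter> sphere 0 1"
  have "compact K" unfolding K_def
    by (intro closed_Int_compact closed_subspace S compact_sphere)
  obtain z where z: "z \<in> S" "z \<noteq> 0" using S subspace_0 by blast
  have "z /\<^sub>R norm z \<in> K" unfolding K_def using z S by (auto intro: subspace_scale)
  hence "K \<noteq> {}" by blast
  have "continuous_on K (\<lambda>x. T x \<bullet> x)"
    by (intro continuous_intros linear_continuous_on linear_linear[THEN iffD1] lin)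
       (simp add: linear_linear lin)
  from continuous_attains_sup[OF \<open>compact K\<close> \<open>K \<noteq> {}\<close> this]
  obtain x where x: "x \<in> K" and mx: "\<And>y. y \<in> K \<Longrightarrow> T y \<bullet> y \<le> T x \<bullet> x" by blast
  define e where "e = T x \<bullet> x"
  have xS: "x \<in> S" "norm x = 1" using x unfolding K_def by auto
  have bound: "T y \<bullet> y \<le> e * (y \<bullet> y)" if "y \<in> S" for y
  proof (cases "y = 0")
    case True thus ?thesis using lin by (simp add: linear_0)
  next
    case False
    have "y /\<^sub>R norm y \<in> K" unfolding K_def using False that S by (auto intro: subspace_scale)
    from mx[OF this] show ?thesis unfolding e_def using False
      by (simp add: linear_cmul[OF lin] field_simps power2_norm_eq_inner[symmetric] power2_eq_square)
  qed
  define g where "g = T x - e *\<^sub>R x"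
  have gS: "g \<in> S" unfolding g_def using xS S by (auto intro!: subspace_diff subspace_scale)
  have "g \<bullet> g = 0"
  proof (rule linear_dominated_by_square)
    fix t :: real
    have "x + t *\<^sub>R g \<in> S" using xS gS S by (auto intro: subspace_add subspace_scale)
    from bound[OF this]
    have "T x \<bullet> x + 2 * t * (T x \<bullet> g) + t\<^sup>2 * (T g \<bullet> g)
      \<le> e * (x \<bullet> x + 2 * t * (x \<bullet> g) + t\<^sup>2 * (g \<bullet> g))"
      using sa[of x g] sa[of g x]
      by (simp add: linear_add[OF lin] linear_cmul[OF lin] inner_simps power2_eq_square
          inner_commute algebra_simps)
    moreover have "x \<bullet> x = 1" using xS by (simp add: dot_square_norm)
    moreover have "T x \<bullet> g = g \<bullet> g + e * (x \<bullet> g)" unfolding g_def by (simp add: inner_simps algebra_simps inner_commute)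
    ultimately show "2 * t * (g \<bullet> g) \<le> t\<^sup>2 * (e * (g \<bullet> g) - T g \<bullet> g)"
      unfolding e_def by (simp add: algebra_simps)
  qed
  hence "T x = e *\<^sub>R x" unfolding g_def by simp
  with xS show ?thesis by (rule that)
qed

text \<open>The orthogonal complement of an eigenvector is again invariant under a selfadjoint map, so
  eigenvectors can be split off one at a time.\<close>
lemma selfadjoint_orthonormal_eigenbasis:
  fixes T :: "'a::euclidean_space \<Rightarrow> 'a"
  assumes lin: "linear T" and sa: "\<And>x y. T x \<bullet> y = x \<bullet> T y"
    and "subspace S" "T ` S \<subseteq> S"
  shows "\<exists>B. B \<subseteq> S \<and> pairwise orthogonal B \<and> span B = S \<and>
           (\<forall>b\<in>B. norm b = 1 \<and> (\<exists>e. T b = e *\<^sub>R b))"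
  using assms(3,4)
proof (induction "dim S" arbitrary: S rule: less_induct)
  case less
  show ?case
  proof (cases "S = {0}")
    case True thus ?thesis by (intro exI[of _ "{}"]) auto
  next
    case False
    obtain x e where x: "x \<in> S" "norm x = 1" "T x = e *\<^sub>R x"
      using selfadjoint_eigenvector_exists[OF lin sa less.prems(1) False less.prems(2)] by blast
    define S' where "S' = S \<inter> {y. x \<bullet> y = 0}"
    have sub': "subspace S'" unfolding S'_def
      by (intro subspace_inter less.prems subspace_hyperplane)
    have inv': "T ` S' \<subseteq> S'"
    proof
      fix z assume "z \<in> T ` S'"
      then obtain y where y: "z = T y" "y \<in> S" "x \<bullet> y = 0" unfolding S'_def by blast
      have "x \<bullet> z = 0" using sa[of x y] y x(3) by simp
      thus "z \<in> S'" using y less.prems(2) unfolding S'_def by auto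
    qed
    have xx: "x \<bullet> x = 1" using x by (simp add: dot_square_norm)
    have "x \<notin> S'" using xx unfolding S'_def by simp
    moreover have "S' \<subseteq> S" unfolding S'_def by simp
    ultimately have "span S' \<subset> span S"
      using x(1) sub' less.prems(1) by (metis psubsetI span_eq_iff)
    hence "dim S' < dim S" by (rule dim_psubset)
    from less.hyps[OF this sub' inv'] obtain B where
      B: "B \<subseteq> S'" "pairwise orthogonal B" "span B = S'"
        "\<forall>b\<in>B. norm b = 1 \<and> (\<exists>e. T b = e *\<^sub>R b)" by blast
    have "span (insert x B) = S"
    proof
      show "span (insert x B) \<subseteq> S"
        using B x less.prems(1) unfolding S'_def by (intro span_minimal) auto
      show "S \<subseteq> span (insert x B)"
      proof
        fix y assume "y \<in> S"
        hence "y - (x \<bullet> y) *\<^sub>R x \<in> span B"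
          unfolding B S'_def using x xx less.prems(1)
          by (auto intro!: subspace_diff subspace_scale simp: inner_simps)
        thus "y \<in> span (insert x B)" by (auto simp: span_insert)
      qed
    qed
    moreover have "pairwise orthogonal (insert x B)"
      using B(1,2) unfolding S'_def
      by (auto simp: pairwise_insert orthogonal_def inner_commute)
    ultimately show ?thesis using B x unfolding S'_def
      by (intro exI[of _ "insert x B"]) auto
  qed
qed

lemma symmetric_matrix_inner:
  fixes Q :: "real^'d^'d"
  assumes "transpose Q = Q"
  shows "(Q *v x) \<bullet> y = x \<bullet> (Q *v y)"
  using assms by (metis dot_lmul_matrix vector_transpose_matrix)

text \<open>The rows of \<open>U\<close> are an orthonormal eigenbasis; the diagonal form of \<open>Q\<close> is stated through the
  coordinates \<open>U *v x\<close>, which is how it is used on the iterates.\<close>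
lemma symmetric_matrix_diagonalization:
  fixes Q :: "real^'d^'d"
  assumes "transpose Q = Q"
  obtains U :: "real^'d^'d" and e :: "'d \<Rightarrow> real"
  where "orthogonal_matrix U" "\<And>x j. (U *v (Q *v x)) $ j = e j * (U *v x) $ j"
proof -
  note sa = symmetric_matrix_inner[OF assms]
  obtain B where B: "pairwise orthogonal B" "span B = (UNIV :: (real^'d) set)"
    "\<forall>b\<in>B. norm b = 1 \<and> (\<exists>e. Q *v b = e *\<^sub>R b)"
    using selfadjoint_orthonormal_eigenbasis[of "(*v) Q" UNIV] sa by auto
  have ind: "independent B"
    using B by (intro pairwise_orthogonal_independent) auto
  have "card B = CARD('d)"
    using dim_eq_card[OF _ ind, of UNIV] B(2) by (simp add: dim_UNIV)
  moreover have "finite B" using ind independent_bound_general finiteI_independent by blast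
  ultimately obtain g where g: "bij_betw g (UNIV :: 'd set) B"
    by (metis finite_same_card_bij finite)
  have gB: "g j \<in> B" for j using g by (auto simp: bij_betw_def)
  have "\<forall>j. \<exists>e. Q *v g j = e *\<^sub>R g j" using B(3) gB by blast
  then obtain e where e: "\<And>j. Q *v g j = e j *\<^sub>R g j" by (auto simp: choice_iff)
  define U where "U = (\<chi> i. g i)"
  have row: "row i U = g i" for i unfolding U_def row_def by (simp add: vec_eq_iff)
  have "orthogonal_matrix U"
    unfolding orthogonal_matrix_orthonormal_rows row
    using B(1,3) g unfolding pairwise_def bij_betw_def inj_def by (metis rangeI)
  moreover have "(U *v (Q *v x)) $ j = e j * (U *v x) $ j" for x j
    using sa[of "g j" x] e[of j] unfolding U_def by (simp add: matrix_vector_mul_component)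
  ultimately show ?thesis by (rule that)
qed

section \<open>The spectrum of the momentum matrix\<close>

lemma orthogonal_matrix_inject:
  fixes U :: "real^'d^'d"
  assumes U: "orthogonal_matrix U"
  shows "U *v x = U *v y \<longleftrightarrow> x = y"
proof
  assume "U *v x = U *v y"
  hence "(transpose U ** U) *v x = (transpose U ** U) *v y"
    by (simp flip: matrix_vector_mul_assoc)
  thus "x = y" using U by (simp add: orthogonal_matrix_def)
qed simp

lemma diagonalization_eigenvector:
  fixes Q U :: "real^'d^'d"
  assumes U: "orthogonal_matrix U" and diag: "\<And>x j. (U *v (Q *v x)) $ j = e j * (U *v x) $ j"
  obtains v where "v \<noteq> 0" "Q *v v = e j *\<^sub>R v"
proof -
  define v where "v = transpose U *v axis j 1"
  have Uv: "U *v v = axis j 1"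
    using U unfolding v_def orthogonal_matrix_def
    by (simp add: matrix_vector_mul_assoc del: transpose_matrix_vector)
  have "U *v (Q *v v) = U *v (e j *\<^sub>R v)"
    by (auto simp: vec_eq_iff diag matrix_vector_mult_scaleR Uv axis_def)
  hence "Q *v v = e j *\<^sub>R v" by (simp add: orthogonal_matrix_inject[OF U])
  moreover have "v \<noteq> 0" using Uv by (metis axis_eq_0_iff matrix_vector_mult_0_right one_neq_zero)
  ultimately show ?thesis using that by blast
qed

text \<open>Feasibility and the constants of the rate depend only on the set of eigenvalues, so equality of
  the two sets is enough to pass from the ordered list \<open>lam\<close> to the diagonal entries \<open>e\<close>.\<close>
lemma diagonalization_eigenvalues:
  fixes Q U :: "real^'d^'d"
  assumes U: "orthogonal_matrix U" and diag: "\<And>x j. (U *v (Q *v x)) $ j = e j * (U *v x) $ j"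
    and lam: "ordered_eigenvalues Q lam"
  shows "lam ` {1..CARD('d)} = range e"
proof -
  have mat: "(mat l - Q) *v v = l *\<^sub>R v - Q *v v" for l v
    by (simp add: matrix_vector_mult_diff_rdistrib vec_eq_iff matrix_vector_mult_def mat_def
        left_diff_distrib sum_subtractf if_distrib[where f="\<lambda>x. x * _"] cong: if_cong)
  have "l \<in> lam ` {1..CARD('d)} \<longleftrightarrow> det (mat l - Q) = 0" for l
    using lam unfolding ordered_eigenvalues_def by auto
  also have "\<dots> l \<longleftrightarrow> (\<exists>v. v \<noteq> 0 \<and> Q *v v = l *\<^sub>R v)" for l
    using matrix_left_invertible_ker[of "mat l - Q"]
    unfolding mat invertible_left_inverse[symmetric] invertible_det_nz by auto
  also have "\<dots> l \<longleftrightarrow> l \<in> range e" for l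
  proof
    assume "\<exists>v. v \<noteq> 0 \<and> Q *v v = l *\<^sub>R v"
    then obtain v where v: "v \<noteq> 0" "Q *v v = l *\<^sub>R v" by blast
    have "U *v v \<noteq> 0" using orthogonal_matrix_inject[OF U, of v 0] v by simp
    then obtain j where j: "(U *v v) $ j \<noteq> 0" by (auto simp: vec_eq_iff)
    have "l * (U *v v) $ j = e j * (U *v v) $ j"
      using diag[of v j] v by (simp add: matrix_vector_mult_scaleR)
    thus "l \<in> range e" using j by auto
  next
    assume "l \<in> range e"
    then obtain j where "l = e j" by blast
    thus "\<exists>v. v \<noteq> 0 \<and> Q *v v = l *\<^sub>R v"
      using diagonalization_eigenvector[OF U diag] by metis
  qed
  finally show ?thesis by blast
qed

text \<open>The lower block row forces the upper half of an eigenvector to be \<open>z\<close> times the lower half.\<close>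
lemma gmm_matrix_eigenvector_iff:
  fixes Q :: "real^'d^'d" and v :: "complex^('d + 'd)"
  shows "(\<chi> i j. complex_of_real (gmm_matrix Q \<alpha> \<beta> \<gamma> $ i $ j)) *v v = z *s v \<longleftrightarrow>
    (\<forall>a. (1 + \<beta>) * v $ Inl a - \<alpha> * (1 + \<gamma>) * (\<Sum>b\<in>UNIV. Q $ a $ b * v $ Inl b)
        - (\<beta> * v $ Inr a - \<alpha> * \<gamma> * (\<Sum>b\<in>UNIV. Q $ a $ b * v $ Inr b)) = z * v $ Inl a) \<and>
    (\<forall>a. v $ Inl a = z * v $ Inr a)"
proof -
  have split: "(\<Sum>j\<in>UNIV. g j) = (\<Sum>b\<in>UNIV. g (Inl b)) + (\<Sum>b\<in>UNIV. g (Inr b))"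
    for g :: "'d + 'd \<Rightarrow> complex"
    by (subst UNIV_Plus_UNIV[symmetric]) (simp add: sum.Plus del: UNIV_Plus_UNIV)
  have all: "(\<forall>i. P i) \<longleftrightarrow> (\<forall>a. P (Inl a)) \<and> (\<forall>a. P (Inr a))" for P :: "'d + 'd \<Rightarrow> bool"
    by (metis sum.exhaust)
  have m: "(\<Sum>b\<in>UNIV. complex_of_real (mat k $ a $ b) * g b) = k * g a" for k :: real and a :: 'd and g :: "'d \<Rightarrow> complex"
    by (simp add: mat_def if_distrib[where f="\<lambda>x. complex_of_real x * _"] cong: if_cong)
  have m': "(\<Sum>b\<in>UNIV. g b * complex_of_real (mat k $ a $ b)) = k * g a" for k :: real and a :: 'd and g :: "'d \<Rightarrow> complex"
    using m[of k a g] by (simp add: mult.commute)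
  show ?thesis
    unfolding vec_eq_iff all
    by (simp add: matrix_vector_mult_def split gmm_matrix_def block_matrix_def m m' algebra_simps
        sum_subtractf sum.distrib sum_distrib_left sum_negf)
qed

text \<open>Applying a row of \<open>U\<close> to both halves of an eigenvector turns the block equation into the
  characteristic equation of one mode, multiplied by the corresponding coordinate of the lower half;
  some coordinate is nonzero. Conversely, a root \<open>z\<close> and a real eigenvector \<open>q\<close> of \<open>Q\<close> give the
  eigenvector with halves \<open>z q\<close> and \<open>q\<close>.\<close>
lemma complex_spectrum_gmm_matrix:
  fixes Q U :: "real^'d^'d"
  assumes U: "orthogonal_matrix U" and diag: "\<And>x j. (U *v (Q *v x)) $ j = e j * (U *v x) $ j"
  shows "complex_spectrum (gmm_matrix Q \<alpha> \<beta> \<gamma>)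
    = (\<Union>j. {z. z\<^sup>2 = gmm_c \<alpha> \<beta> \<gamma> (e j) * z + gmm_d \<alpha> \<beta> \<gamma> (e j)})"
proof (intro equalityI subsetI)
  fix z assume "z \<in> complex_spectrum (gmm_matrix Q \<alpha> \<beta> \<gamma>)"
  then obtain v :: "complex^('d + 'd)" where v0: "v \<noteq> 0" and
    ev: "(\<chi> i j. complex_of_real (gmm_matrix Q \<alpha> \<beta> \<gamma> $ i $ j)) *v v = z *s v"
    unfolding complex_spectrum_def by auto
  note v = ev[unfolded gmm_matrix_eigenvector_iff, THEN conjunct1, rule_format]
    ev[unfolded gmm_matrix_eigenvector_iff, THEN conjunct2, rule_format]
  \<comment> \<open>The complex-linear extension of the \<open>j\<close>-th coordinate functional.\<close>
  define \<phi> where "\<phi> j g = (\<Sum>a\<in>UNIV. complex_of_real (U $ j $ a) * g a)" for j and g :: "'d \<Rightarrow> complex"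
  have row: "(\<Sum>a\<in>UNIV. U $ j $ a * Q $ a $ b) = e j * U $ j $ b" for j b
    using diag[of "axis b 1" j]
    by (simp add: matrix_vector_mult_basis column_def) (simp add: matrix_vector_mult_def)
  have \<phi>Q: "\<phi> j (\<lambda>a. \<Sum>b\<in>UNIV. Q $ a $ b * g b) = e j * \<phi> j g" for j and g :: "'d \<Rightarrow> complex"
  proof -
    have "\<phi> j (\<lambda>a. \<Sum>b\<in>UNIV. Q $ a $ b * g b)
      = (\<Sum>b\<in>UNIV. complex_of_real (\<Sum>a\<in>UNIV. U $ j $ a * Q $ a $ b) * g b)"
      unfolding \<phi>_def sum_distrib_left by (subst sum.swap) (simp add: sum_distrib_right mult.assoc)
    also have "\<dots> = e j * \<phi> j g" unfolding row \<phi>_def by (simp add: sum_distrib_left mult.assoc)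
    finally show ?thesis .
  qed
  have cols: "(\<Sum>j\<in>UNIV. U $ j $ a * U $ j $ b) = (if a = b then 1 else 0)" for a b
  proof -
    have "(transpose U ** U) $ a $ b = mat 1 $ a $ b" using U unfolding orthogonal_matrix_def by simp
    thus ?thesis by (simp add: matrix_matrix_mult_def transpose_def mat_def)
  qed
  have \<phi>_inj: "g a = 0" if "\<And>j. \<phi> j g = 0" for g :: "'d \<Rightarrow> complex" and a
  proof -
    have "0 = (\<Sum>j\<in>UNIV. U $ j $ a * \<phi> j g)" using that by simp
    also have "\<dots> = (\<Sum>b\<in>UNIV. complex_of_real (\<Sum>j\<in>UNIV. U $ j $ a * U $ j $ b) * g b)"
      unfolding \<phi>_def sum_distrib_left by (subst sum.swap) (simp add: sum_distrib_right mult.assoc)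
    also have "\<dots> = g a" unfolding cols
      by (simp add: if_distrib[where f="\<lambda>x. complex_of_real x * _"] cong: if_cong)
    finally show ?thesis by simp
  qed
  have \<phi>v: "\<phi> j (\<lambda>a. v $ Inl a) = z * \<phi> j (\<lambda>a. v $ Inr a)" for j
    unfolding \<phi>_def v(2) by (simp add: sum_distrib_left mult_ac)
  obtain j where j: "\<phi> j (\<lambda>a. v $ Inr a) \<noteq> 0"
  proof (rule ccontr)
    assume "\<not> thesis"
    hence "v $ Inr a = 0" for a using \<phi>_inj[of "\<lambda>a. v $ Inr a"] that by blast
    hence "v $ i = 0" for i by (cases i) (auto simp: v(2))
    thus False using v0 by (simp add: vec_eq_iff)
  qed
  define t where "t = \<phi> j (\<lambda>a. v $ Inr a)"
  have "\<phi> j (\<lambda>a. z * v $ Inl a) = (1 + \<beta>) * \<phi> j (\<lambda>a. v $ Inl a)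
      - \<alpha> * (1 + \<gamma>) * \<phi> j (\<lambda>a. \<Sum>b\<in>UNIV. Q $ a $ b * v $ Inl b)
      - (\<beta> * \<phi> j (\<lambda>a. v $ Inr a) - \<alpha> * \<gamma> * \<phi> j (\<lambda>a. \<Sum>b\<in>UNIV. Q $ a $ b * v $ Inr b))"
    unfolding v(1)[symmetric] unfolding \<phi>_def
    by (simp add: sum_distrib_left[symmetric] sum_subtractf[symmetric] algebra_simps)
       (simp add: sum_distrib_left sum_subtractf[symmetric] sum.distrib[symmetric] algebra_simps)
  moreover have "\<phi> j (\<lambda>a. z * v $ Inl a) = z * \<phi> j (\<lambda>a. v $ Inl a)"
    unfolding \<phi>_def by (simp add: sum_distrib_left mult_ac)
  ultimately have "t * z\<^sup>2 = t * (gmm_c \<alpha> \<beta> \<gamma> (e j) * z + gmm_d \<alpha> \<beta> \<gamma> (e j))"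
    unfolding \<phi>Q \<phi>v t_def[symmetric] gmm_c_def gmm_d_def
    by (simp add: algebra_simps power2_eq_square)
  thus "z \<in> (\<Union>j. {z. z\<^sup>2 = gmm_c \<alpha> \<beta> \<gamma> (e j) * z + gmm_d \<alpha> \<beta> \<gamma> (e j)})"
    using j t_def by auto
next
  fix z :: complex
  assume "z \<in> (\<Union>j. {z. z\<^sup>2 = gmm_c \<alpha> \<beta> \<gamma> (e j) * z + gmm_d \<alpha> \<beta> \<gamma> (e j)})"
  then obtain j where z: "z\<^sup>2 = gmm_c \<alpha> \<beta> \<gamma> (e j) * z + gmm_d \<alpha> \<beta> \<gamma> (e j)" by blast
  obtain q where q: "q \<noteq> 0" "Q *v q = e j *\<^sub>R q"
    using diagonalization_eigenvector[OF U diag] by metis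
  have Qq: "(\<Sum>b\<in>UNIV. complex_of_real (Q $ a $ b) * complex_of_real (q $ b)) = e j * q $ a" for a
    using q(2) by (simp add: vec_eq_iff matrix_vector_mult_def flip: of_real_mult of_real_sum)
  define v where "v = (\<chi> i. case i of Inl a \<Rightarrow> z * complex_of_real (q $ a) | Inr a \<Rightarrow> complex_of_real (q $ a))"
  have "v \<noteq> 0" using q(1) unfolding v_def by (auto simp: vec_eq_iff intro: exI[of _ "Inr _"])
  moreover have "(\<chi> i j. complex_of_real (gmm_matrix Q \<alpha> \<beta> \<gamma> $ i $ j)) *v v = z *s v"
  proof -
    have zq: "(\<Sum>b\<in>UNIV. complex_of_real (Q $ a $ b) * (z * complex_of_real (q $ b))) = z * (e j * q $ a)" for a
    proof -
      have "(\<Sum>b\<in>UNIV. complex_of_real (Q $ a $ b) * (z * complex_of_real (q $ b)))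
        = z * (\<Sum>b\<in>UNIV. complex_of_real (Q $ a $ b) * complex_of_real (q $ b))"
        by (simp add: sum_distrib_left mult_ac)
      thus ?thesis unfolding Qq by simp
    qed
    have "(1 + \<beta>) * (z * q $ a) - \<alpha> * (1 + \<gamma>) * (z * (e j * q $ a))
        - (\<beta> * q $ a - \<alpha> * \<gamma> * (e j * q $ a)) = z * (z * q $ a)" for a
    proof -
      have "z * (z * q $ a) = z\<^sup>2 * q $ a" by (simp add: power2_eq_square)
      thus ?thesis unfolding z gmm_c_def gmm_d_def by (simp add: algebra_simps)
    qed
    thus ?thesis unfolding gmm_matrix_eigenvector_iff v_def by (simp add: Qq zq)
  qed
  ultimately show "z \<in> complex_spectrum (gmm_matrix Q \<alpha> \<beta> \<gamma>)"
    unfolding complex_spectrum_def by blast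
qed

section \<open>The scalar two-term recursion\<close>

text \<open>The impulse response of the recursion, shifted so that the unit impulse has index one. With this
  indexing the mean of a mode, its variance and the addition formula have no exceptional terms.\<close>
fun impulse :: "real \<Rightarrow> real \<Rightarrow> nat \<Rightarrow> real" where
  "impulse c d 0 = 0"
| "impulse c d (Suc 0) = 1"
| "impulse c d (Suc (Suc n)) = c * impulse c d (Suc n) + d * impulse c d n"

text \<open>Both sides solve the recursion in \<open>k\<close>. The formula expresses the response after time \<open>k\<close> through
  its two values at time \<open>k\<close>, which turns pointwise decay into decay of tails.\<close>
lemma impulse_add:
  "impulse c d (k + Suc j) = impulse c d (Suc k) * impulse c d (Suc j) + d * impulse c d k * impulse c d j"
proof (induction k arbitrary: j)
  case 0 show ?case by simp
next
  case (Suc k)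
  from Suc[of "Suc j"] show ?case by (simp add: algebra_simps)
qed

text \<open>The left-hand side is the determinant of two consecutive states, and one step of the recursion
  multiplies it by \<open>- d\<close>.\<close>
lemma impulse_casoratian:
  "(impulse c d (Suc n))\<^sup>2 - impulse c d (Suc (Suc n)) * impulse c d n = (- d) ^ n"
proof (induction n)
  case (Suc n)
  have "(impulse c d (Suc (Suc n)))\<^sup>2 - impulse c d (Suc (Suc (Suc n))) * impulse c d (Suc n)
    = - d * ((impulse c d (Suc n))\<^sup>2 - impulse c d (Suc (Suc n)) * impulse c d n)"
    by (simp add: power2_eq_square algebra_simps)
  with Suc show ?case by simp
qed simp

lemma summable_square_mult:
  fixes f g :: "nat \<Rightarrow> real"
  assumes "summable (\<lambda>n. (f n)\<^sup>2)" "summable (\<lambda>n. (g n)\<^sup>2)"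
  shows "summable (\<lambda>n. f n * g n)"
proof (rule summable_comparison_test')
  show "summable (\<lambda>n. (f n)\<^sup>2 + (g n)\<^sup>2)" by (intro summable_add assms)
  fix n
  have "2 * \<bar>f n * g n\<bar> \<le> (f n)\<^sup>2 + (g n)\<^sup>2"
    using sum_squares_bound[of "\<bar>f n\<bar>" "\<bar>g n\<bar>"] by (simp add: abs_mult)
  moreover have "0 \<le> (f n)\<^sup>2 + (g n)\<^sup>2" by simp
  ultimately show "norm (f n * g n) \<le> (f n)\<^sup>2 + (g n)\<^sup>2" by simp
qed

text \<open>With \<open>S\<close> the sum of the squares and \<open>T\<close> the sum of the products of neighbours, multiplying the
  recursion by \<open>h\<^sub>n\<^sub>+\<^sub>1\<close> and summing gives \<open>T = c S + d T\<close>, while squaring and summing gives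
  \<open>S - 1 = (c\<^sup>2 + d\<^sup>2) S + 2 c d T\<close>; eliminating \<open>T\<close> yields the formula for \<open>S\<close>. Square
  summability sends the Casoratian \<open>(- d)\<^sup>n\<close> to zero, so \<open>\<bar>d\<bar> < 1\<close>, and then positivity of \<open>S\<close> in
  the formula forces \<open>c\<^sup>2 < (1 - d)\<^sup>2\<close>.\<close>
lemma impulse_energy:
  assumes sm: "summable (\<lambda>n. (impulse c d n)\<^sup>2)"
  defines "S \<equiv> (\<Sum>n. (impulse c d n)\<^sup>2)"
  shows "\<bar>d\<bar> < 1" "\<bar>c\<bar> < 1 - d" "S * ((1 + d) * ((1 - d)\<^sup>2 - c\<^sup>2)) = 1 - d" "1 \<le> S"
proof -
  let ?h = "impulse c d"
  have sm1: "summable (\<lambda>n. (?h (Suc n))\<^sup>2)" and sm2: "summable (\<lambda>n. (?h (Suc (Suc n)))\<^sup>2)"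
    using sm summable_Suc_iff[of "\<lambda>n. (?h n)\<^sup>2"] summable_Suc_iff[of "\<lambda>n. (?h (Suc n))\<^sup>2"] by blast+
  have smT: "summable (\<lambda>n. ?h n * ?h (Suc n))" by (rule summable_square_mult[OF sm sm1])
  define T where "T = (\<Sum>n. ?h n * ?h (Suc n))"
  have S1: "(\<Sum>n. (?h (Suc n))\<^sup>2) = S"
    using suminf_split_head[OF sm] by (simp add: S_def)
  have S2: "(\<Sum>n. (?h (Suc (Suc n)))\<^sup>2) = S - 1"
    using suminf_split_head[OF sm1] S1 by simp
  have T1: "(\<Sum>n. ?h (Suc n) * ?h (Suc (Suc n))) = T"
    using suminf_split_head[OF smT] by (simp add: T_def)
  have "(\<lambda>n. c * (?h (Suc n))\<^sup>2 + d * (?h n * ?h (Suc n))) sums (c * S + d * T)"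
    unfolding S1[symmetric] T_def
    by (intro sums_add sums_mult summable_sums sm1 smT)
  moreover have "(\<lambda>n. c * (?h (Suc n))\<^sup>2 + d * (?h n * ?h (Suc n))) = (\<lambda>n. ?h (Suc n) * ?h (Suc (Suc n)))"
    by (auto simp: power2_eq_square algebra_simps)
  ultimately have eqT: "T = c * S + d * T" using T1 by (simp add: sums_iff)
  have "(\<lambda>n. c\<^sup>2 * (?h (Suc n))\<^sup>2 + d\<^sup>2 * (?h n)\<^sup>2 + 2 * c * d * (?h n * ?h (Suc n)))
      sums (c\<^sup>2 * S + d\<^sup>2 * S + 2 * c * d * T)"
    unfolding T_def by (subst S1[symmetric], unfold S_def)
      (intro sums_add sums_mult summable_sums sm sm1 smT)
  moreover have "(\<lambda>n. c\<^sup>2 * (?h (Suc n))\<^sup>2 + d\<^sup>2 * (?h n)\<^sup>2 + 2 * c * d * (?h n * ?h (Suc n)))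
      = (\<lambda>n. (?h (Suc (Suc n)))\<^sup>2)"
    by (auto simp: power2_eq_square algebra_simps)
  ultimately have eqS: "S - 1 = c\<^sup>2 * S + d\<^sup>2 * S + 2 * c * d * T" using S2 by (simp add: sums_iff)
  have "(1 - d) * (S - 1) = (1 - d) * (c\<^sup>2 * S + d\<^sup>2 * S) + 2 * c * d * ((1 - d) * T)"
    unfolding eqS by (simp add: algebra_simps)
  moreover have "(1 - d) * T = c * S" using eqT by (simp add: algebra_simps)
  ultimately have "(1 - d) * (S - 1) = (1 - d) * (c\<^sup>2 * S + d\<^sup>2 * S) + 2 * c * d * (c * S)" by simp
  thus e: "S * ((1 + d) * ((1 - d)\<^sup>2 - c\<^sup>2)) = 1 - d"
    by (simp add: power2_eq_square algebra_simps)
  show S_ge: "1 \<le> S"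
  proof -
    have "0 \<le> (\<Sum>n. (?h (Suc (Suc n)))\<^sup>2)" by (intro suminf_nonneg sm2) auto
    thus ?thesis using S2 by simp
  qed
  have "(\<lambda>n. (?h n)\<^sup>2) \<longlonglongrightarrow> 0" using summable_LIMSEQ_zero[OF sm] .
  hence h0: "?h \<longlonglongrightarrow> 0" by (simp add: power_tendsto_0_iff)
  have "(\<lambda>n. (?h (Suc n))\<^sup>2 - ?h (Suc (Suc n)) * ?h n) \<longlonglongrightarrow> 0\<^sup>2 - 0 * 0"
    by (intro tendsto_intros h0 LIMSEQ_Suc)
  hence "(\<lambda>n. (- d) ^ n) \<longlonglongrightarrow> 0" unfolding impulse_casoratian by simp
  from LIMSEQ_D[OF this, of 1] obtain n where "\<bar>d\<bar> ^ n < 1" by (auto simp: power_abs)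
  thus d: "\<bar>d\<bar> < 1" using one_le_power[of "\<bar>d\<bar>" n] by linarith
  have "0 < S * (1 + d)" using d S_ge by simp
  moreover have "0 < S * (1 + d) * ((1 - d)\<^sup>2 - c\<^sup>2)" using e d by (simp add: mult.assoc)
  ultimately have "0 < (1 - d)\<^sup>2 - c\<^sup>2" by (rule zero_less_mult_pos[rotated])
  hence "c\<^sup>2 < (1 - d)\<^sup>2" by simp
  thus "\<bar>c\<bar> < 1 - d" using d abs_le_square_iff[of "1 - d" c] by (simp add: not_le[symmetric])
qed

text \<open>The first root is a dominant one, so \<open>rate_rho\<close> is the larger modulus of the two.\<close>
lemma characteristic_roots:
  obtains r1 r2 :: complex where "r1 + r2 = of_real c" "r1 * r2 = - of_real d"
    "cmod (r1 - r2) = sqrt \<bar>c\<^sup>2 + 4 * d\<bar>" "cmod r1 = rate_rho c d" "cmod r2 \<le> rate_rho c d"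
proof (cases "c\<^sup>2 + 4 * d \<ge> 0")
  case True
  define s where "s = sqrt (c\<^sup>2 + 4 * d)"
  have s: "s \<ge> 0" "s\<^sup>2 = c\<^sup>2 + 4 * d" using True unfolding s_def by auto
  \<comment> \<open>The sign of the square root is chosen so that the first root is the dominant one.\<close>
  define g :: real where "g = (if c \<ge> 0 then s else - s)"
  have g: "\<bar>g\<bar> = s" "\<bar>c + g\<bar> = \<bar>c\<bar> + s" "\<bar>c - g\<bar> \<le> \<bar>c\<bar> + s" "g * g = c * c + 4 * d"
    using s unfolding g_def by (auto simp: power2_eq_square)
  show ?thesis
  proof (rule that[of "of_real ((c + g) / 2)" "of_real ((c - g) / 2)"])
    have "(c + g) / 2 + (c - g) / 2 = c" by (simp add: field_simps)
    thus "complex_of_real ((c + g) / 2) + of_real ((c - g) / 2) = of_real c"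
      by (metis of_real_add)
    have "(c + g) / 2 * ((c - g) / 2) = - d" using g(4) by (simp add: field_simps)
    thus "complex_of_real ((c + g) / 2) * of_real ((c - g) / 2) = - of_real d"
      by (metis of_real_minus of_real_mult)
    have "(c + g) / 2 - (c - g) / 2 = g" by (simp add: field_simps)
    thus "cmod (of_real ((c + g) / 2) - of_real ((c - g) / 2)) = sqrt \<bar>c\<^sup>2 + 4 * d\<bar>"
      using g(1) True unfolding s_def by (metis abs_of_nonneg norm_of_real of_real_diff)
    show "cmod (of_real ((c + g) / 2)) = rate_rho c d"
      using g(2) True unfolding norm_of_real rate_rho_def s_def by simp
    show "cmod (of_real ((c - g) / 2)) \<le> rate_rho c d"
      using g(3) True unfolding norm_of_real rate_rho_def s_def by simp
  qed
next
  case False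
  define s where "s = sqrt (- (c\<^sup>2 + 4 * d))"
  have s: "s \<ge> 0" "s * s = - (c * c) - 4 * d" using False unfolding s_def by (auto simp: power2_eq_square)
  have d: "\<bar>d\<bar> = - d" using False zero_le_power2[of c] by linarith
  have n: "(c / 2)\<^sup>2 + (s / 2)\<^sup>2 = - d" using s by (simp add: power2_eq_square field_simps)
  show ?thesis
  proof (rule that[of "Complex (c / 2) (s / 2)" "Complex (c / 2) (- s / 2)"])
    show "Complex (c / 2) (s / 2) + Complex (c / 2) (- s / 2) = of_real c" by (simp add: complex_eq_iff)
    show "Complex (c / 2) (s / 2) * Complex (c / 2) (- s / 2) = - of_real d"
      using n by (simp add: complex_eq_iff power2_eq_square)
    show "cmod (Complex (c / 2) (s / 2) - Complex (c / 2) (- s / 2)) = sqrt \<bar>c\<^sup>2 + 4 * d\<bar>"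
      using s False by (simp add: cmod_def s_def)
    show "cmod (Complex (c / 2) (s / 2)) = rate_rho c d" 
      using n False d by (simp add: cmod_def rate_rho_def)
    show "cmod (Complex (c / 2) (- s / 2)) \<le> rate_rho c d" 
      using n False d by (simp add: cmod_def rate_rho_def)
  qed
qed

lemma rate_rho_root:
  obtains z :: complex where "z\<^sup>2 = of_real c * z + of_real d" "cmod z = rate_rho c d"
proof -
  obtain r1 r2 where r: "r1 + r2 = of_real c" "r1 * r2 = - of_real d" "cmod r1 = rate_rho c d"
    by (metis characteristic_roots)
  have "r1\<^sup>2 = (r1 + r2) * r1 - r1 * r2" by (simp add: power2_eq_square algebra_simps)
  thus ?thesis using r that by simp
qed

lemma root_le_rate_rho:
  fixes z :: complex
  assumes "z\<^sup>2 = of_real c * z + of_real d"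
  shows "cmod z \<le> rate_rho c d"
proof -
  obtain r1 r2 where r: "r1 + r2 = of_real c" "r1 * r2 = - of_real d" "cmod r1 = rate_rho c d"
     "cmod r2 \<le> rate_rho c d"
    by (metis characteristic_roots)
  have "(z - r1) * (z - r2) = z\<^sup>2 - (r1 + r2) * z + r1 * r2" by (simp add: power2_eq_square algebra_simps)
  also have "\<dots> = 0" using r assms by simp
  finally show ?thesis using r by auto
qed

lemma rate_rho_nonneg: "0 \<le> rate_rho c d"
  by (metis norm_ge_zero rate_rho_root)

lemma rate_rho_less_1:
  assumes "\<bar>d\<bar> < 1" "\<bar>c\<bar> < 1 - d"
  shows "rate_rho c d < 1"
proof (cases "c\<^sup>2 + 4 * d \<ge> 0")
  case True
  have "c\<^sup>2 + 4 * d < (2 - \<bar>c\<bar>)\<^sup>2" using assms by (simp add: power2_eq_square algebra_simps)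
  hence "sqrt (c\<^sup>2 + 4 * d) < 2 - \<bar>c\<bar>" using assms by (intro real_less_lsqrt) auto
  thus ?thesis using True by (simp add: rate_rho_def)
next
  case False
  thus ?thesis using assms by (simp add: rate_rho_def)
qed

lemma rate_C_nonneg: "0 \<le> rate_C c d k"
  unfolding rate_C_def by (simp add: rate_rho_nonneg add_nonneg_nonneg)

text \<open>If the characteristic roots differ, Binet's formula divides a difference of two powers by the
  difference of the roots, which is where the discriminant in \<open>rate_C\<close> comes from; the factor
  \<open>c\<^sup>2 + 2 d + 2\<close> of \<open>rate_C\<close> is a positive constant and is compensated in front. If the roots
  coincide, the response is \<open>k (c / 2)\<^sup>k\<^sup>-\<^sup>1\<close>, and the linear factor is dominated by \<open>rate_C\<close>.\<close>
lemma impulse_decay: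
  assumes "- 1 < d" "1 \<le> k"
  shows "\<bar>impulse c d k\<bar> \<le> (1 + 2 / (c\<^sup>2 + 2 * d + 2)) * (rate_C c d k * rate_rho c d ^ (k - 1))"
proof (cases "c\<^sup>2 + 4 * d = 0")
  case True
  have imp: "impulse c d (Suc n) = (real n + 1) * (c / 2) ^ n \<and>
      impulse c d (Suc (Suc n)) = (real n + 2) * (c / 2) ^ (Suc n)" for n
  proof (induction n)
    case (Suc n)
    have d: "d = - (c / 2) * (c / 2)" using True by (simp add: power2_eq_square)
    have "impulse c d (Suc (Suc (Suc n))) = c * impulse c d (Suc (Suc n)) + d * impulse c d (Suc n)"
      by (rule impulse.simps(3))
    also have "\<dots> = c * ((real n + 2) * (c / 2) ^ Suc n) + d * ((real n + 1) * (c / 2) ^ n)"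
      using Suc by (simp only:)
    also have "\<dots> = (real (Suc n) + 2) * (c / 2) ^ Suc (Suc n)"
      unfolding d by (simp add: field_simps)
    finally show ?case using Suc by (simp add: add.commute del: impulse.simps)
  qed simp
  obtain n where k: "k = Suc n" using assms by (cases k) auto
  have rho: "rate_rho c d = \<bar>c / 2\<bar>" using True by (simp add: rate_rho_def)
  have eq: "\<bar>impulse c d k\<bar> = real k * rate_rho c d ^ (k - 1)"
    using imp[of n] unfolding k rho by (simp add: abs_mult power_abs)
  have "sqrt ((real k)\<^sup>2) \<le> sqrt (2 * (rate_rho c d)\<^sup>2 + (real k)\<^sup>2)" by (intro real_sqrt_le_mono) auto
  hence "real k \<le> sqrt (2 * (rate_rho c d)\<^sup>2 + (real k)\<^sup>2)" by simp
  also have "\<dots> \<le> (c\<^sup>2 / 4 + 2) * sqrt (2 * (rate_rho c d)\<^sup>2 + (real k)\<^sup>2)"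
    using mult_right_mono[of 1 "c\<^sup>2 / 4 + 2" "sqrt (2 * (rate_rho c d)\<^sup>2 + (real k)\<^sup>2)"]
    by (simp add: add_nonneg_nonneg)
  also have "\<dots> = rate_C c d k" using True by (simp add: rate_C_def)
  finally have "real k \<le> rate_C c d k" .
  hence "\<bar>impulse c d k\<bar> \<le> 1 * (rate_C c d k * rate_rho c d ^ (k - 1))"
    unfolding eq by (simp add: mult_right_mono rate_rho_nonneg)
  also have "\<dots> \<le> (1 + 2 / (c\<^sup>2 + 2 * d + 2)) * (rate_C c d k * rate_rho c d ^ (k - 1))"
    using assms by (intro mult_right_mono mult_nonneg_nonneg rate_C_nonneg zero_le_power rate_rho_nonneg)
      (auto intro!: divide_nonneg_nonneg add_nonneg_nonneg[of "c\<^sup>2" "2 * d + 2", unfolded add.assoc[symmetric]])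
  finally show ?thesis .
next
  case False
  obtain r1 r2 where r: "r1 + r2 = complex_of_real c" "r1 * r2 = - complex_of_real d"
    "cmod (r1 - r2) = sqrt \<bar>c\<^sup>2 + 4 * d\<bar>" "cmod r1 = rate_rho c d" "cmod r2 \<le> rate_rho c d"
    by (rule characteristic_roots)
  have \<rho>0: "0 \<le> rate_rho c d" by (rule rate_rho_nonneg)
  have binet: "of_real (impulse c d n) * (r1 - r2) = r1 ^ n - r2 ^ n \<and>
    of_real (impulse c d (Suc n)) * (r1 - r2) = r1 ^ Suc n - r2 ^ Suc n" for n
  proof (induction n)
    case (Suc n)
    have "of_real (impulse c d (Suc (Suc n))) * (r1 - r2)
      = of_real c * (of_real (impulse c d (Suc n)) * (r1 - r2)) + of_real d * (of_real (impulse c d n) * (r1 - r2))"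
      by (simp add: algebra_simps)
    also have "\<dots> = (r1 + r2) * (r1 ^ Suc n - r2 ^ Suc n) - r1 * r2 * (r1 ^ n - r2 ^ n)"
      using Suc r by simp
    also have "\<dots> = r1 ^ Suc (Suc n) - r2 ^ Suc (Suc n)" by (simp add: algebra_simps)
    finally show ?case using Suc by blast
  qed simp
  define s where "s = sqrt \<bar>c\<^sup>2 + 4 * d\<bar>"
  have s: "s > 0" using False unfolding s_def by simp
  have "\<bar>impulse c d k\<bar> * s = cmod (r1 ^ k - r2 ^ k)"
    using binet[of k] r(3) unfolding s_def by (metis norm_mult norm_of_real)
  also have "\<dots> \<le> cmod r1 ^ k + cmod r2 ^ k" by (metis norm_power norm_triangle_ineq4)
  also have "\<dots> \<le> rate_rho c d ^ k + rate_rho c d ^ k" using r \<rho>0 by (intro add_mono power_mono) auto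
  finally have "\<bar>impulse c d k\<bar> * s \<le> 2 * rate_rho c d ^ k" by simp
  hence 1: "\<bar>impulse c d k\<bar> \<le> 2 * rate_rho c d ^ k / s" using s by (simp add: field_simps)
  have p: "c\<^sup>2 + 2 * d + 2 > 0" using assms zero_le_power2[of c] by linarith
  have C: "rate_C c d k = (c\<^sup>2 + 2 * d + 2) * rate_rho c d / s"
    using False p unfolding rate_C_def s_def by simp
  have "2 * rate_rho c d ^ k / s = 2 / (c\<^sup>2 + 2 * d + 2) * (rate_C c d k * rate_rho c d ^ (k - 1))"
  proof -
    obtain n where k: "k = Suc n" using assms(2) by (cases k) auto
    have "2 / P * (P * \<rho> / s * \<rho> ^ n) = 2 * \<rho> ^ Suc n / s" if "P > 0" for P \<rho> :: real
      using that by simp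
    from this[OF p, of "rate_rho c d"] show ?thesis unfolding C unfolding k diff_Suc_1 by (rule sym)
  qed
  also have "\<dots> \<le> (1 + 2 / (c\<^sup>2 + 2 * d + 2)) * (rate_C c d k * rate_rho c d ^ (k - 1))"
    by (intro mult_right_mono mult_nonneg_nonneg rate_C_nonneg zero_le_power rate_rho_nonneg) auto
  finally show ?thesis using 1 by simp
qed

text \<open>Only a double root makes the constant depend on \<open>k\<close>, and then it grows linearly.\<close>
lemma rate_C_Suc_le:
  assumes "1 \<le> k"
  shows "rate_C c d (Suc k) \<le> 2 * rate_C c d k"
proof (cases "c\<^sup>2 + 4 * d = 0")
  case True
  have "2 * (rate_rho c d)\<^sup>2 + (real (Suc k))\<^sup>2 \<le> 2\<^sup>2 * (2 * (rate_rho c d)\<^sup>2 + (real k)\<^sup>2)"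
  proof -
    have gen: "2 * R + X \<le> 2\<^sup>2 * (2 * R + Y)" if "0 \<le> R" "X \<le> 2\<^sup>2 * Y" for R X Y :: real
      using that by simp
    have "(real (Suc k))\<^sup>2 \<le> (2 * real k)\<^sup>2" using assms by (intro power_mono) auto
    thus ?thesis unfolding power_mult_distrib by (intro gen) auto
  qed
  hence "sqrt (2 * (rate_rho c d)\<^sup>2 + (real (Suc k))\<^sup>2) \<le> 2 * sqrt (2 * (rate_rho c d)\<^sup>2 + (real k)\<^sup>2)"
    by (metis real_sqrt_le_mono real_sqrt_mult real_sqrt_abs abs_numeral)
  hence "(c\<^sup>2 / 4 + 2) * sqrt (2 * (rate_rho c d)\<^sup>2 + (real (Suc k))\<^sup>2)
      \<le> (c\<^sup>2 / 4 + 2) * (2 * sqrt (2 * (rate_rho c d)\<^sup>2 + (real k)\<^sup>2))"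
    by (intro mult_left_mono) auto
  thus ?thesis using True by (simp add: rate_C_def mult_ac)
next
  case False
  have "rate_C c d (Suc k) = rate_C c d k" using False by (simp add: rate_C_def)
  thus ?thesis using rate_C_nonneg[of c d k] by simp
qed

lemma rate_C_linear_growth: "\<exists>K\<ge>0. \<forall>k. rate_C c d k \<le> K * (1 + real k)"
proof (cases "c\<^sup>2 + 4 * d = 0")
  case True
  let ?K = "(c\<^sup>2 / 4 + 2) * (2 * rate_rho c d + 1)"
  have "sqrt (2 * (rate_rho c d)\<^sup>2 + (real k)\<^sup>2) \<le> (2 * rate_rho c d + 1) * (1 + real k)" for k
  proof -
    have "sqrt (2 * (rate_rho c d)\<^sup>2 + (real k)\<^sup>2) \<le> 2 * rate_rho c d + real k"
      using rate_rho_nonneg[of c d] by (intro real_le_lsqrt) (auto simp: power2_eq_square algebra_simps)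
    also have "\<dots> \<le> (2 * rate_rho c d + 1) * (1 + real k)"
      using rate_rho_nonneg[of c d] by (simp add: algebra_simps)
    finally show ?thesis .
  qed
  hence "rate_C c d k \<le> ?K * (1 + real k)" for k
    using True unfolding rate_C_def mult.assoc
    by (simp del: mult_le_cancel_left) (intro mult_left_mono, auto)
  thus ?thesis using rate_rho_nonneg[of c d] by (intro exI[of _ ?K]) auto
next
  case False
  have "rate_C c d k \<le> rate_C c d 0 * (1 + real k)" for k
  proof -
    have "rate_C c d k = rate_C c d 0" using False by (simp add: rate_C_def)
    thus ?thesis using rate_C_nonneg[of c d 0] by (simp add: algebra_simps)
  qed
  thus ?thesis using rate_C_nonneg[of c d 0] by blast
qed

text \<open>The slightly larger ratio \<open>q\<close> absorbs the linear growth of the constants caused by double roots.\<close>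
lemma linear_times_geometric_bounded:
  fixes \<rho> q :: real
  assumes "0 \<le> \<rho>" "\<rho> < q"
  shows "\<exists>K\<ge>0. \<forall>k\<ge>1. (1 + real k) * \<rho> ^ (k - 1) \<le> K * q ^ k"
proof -
  have q: "q > 0" using assms by simp
  have "(\<lambda>n. real n * (\<rho> / q) ^ n + 2 * (\<rho> / q) ^ n) \<longlonglongrightarrow> 0 + 2 * 0"
    by (intro tendsto_intros powser_times_n_limit_0 LIMSEQ_power_zero) (use assms q in auto)
  hence "Bseq (\<lambda>n. real n * (\<rho> / q) ^ n + 2 * (\<rho> / q) ^ n)"
    by (intro convergent_imp_Bseq convergentI)
  then obtain B where B: "B > 0" "\<And>n. norm (real n * (\<rho> / q) ^ n + 2 * (\<rho> / q) ^ n) \<le> B"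
    by (auto simp: Bseq_def)
  have "(1 + real k) * \<rho> ^ (k - 1) \<le> B / q * q ^ k" if k1: "k \<ge> 1" for k
  proof -
    obtain n where k: "k = Suc n" using k1 by (cases k) auto
    have "(real n + 2) * (\<rho> / q) ^ n \<le> B" using B(2)[of n] by (simp add: algebra_simps)
    hence "(real n + 2) * \<rho> ^ n \<le> B * q ^ n" using q by (simp add: power_divide field_simps)
    thus ?thesis unfolding k using q by (simp add: algebra_simps)
  qed
  thus ?thesis using B q by (intro exI[of _ "B / q"]) auto
qed

lemma impulse_summable:
  assumes "\<bar>d\<bar> < 1" "\<bar>c\<bar> < 1 - d"
  shows "summable (\<lambda>n. (impulse c d n)\<^sup>2)"
proof -
  define q where "q = (1 + rate_rho c d) / 2"
  have q: "rate_rho c d < q" "0 \<le> q" "q < 1"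
    using rate_rho_less_1[OF assms] rate_rho_nonneg[of c d] unfolding q_def by auto
  obtain K1 where K1: "K1 \<ge> 0" "\<And>k. rate_C c d k \<le> K1 * (1 + real k)"
    using rate_C_linear_growth by blast
  obtain K2 where K2: "K2 \<ge> 0" "\<And>k. 1 \<le> k \<Longrightarrow> (1 + real k) * rate_rho c d ^ (k - 1) \<le> K2 * q ^ k"
    using linear_times_geometric_bounded[OF rate_rho_nonneg q(1)] by blast
  define K3 where "K3 = 1 + 2 / (c\<^sup>2 + 2 * d + 2)"
  have "c\<^sup>2 + 2 * d + 2 > 0" using assms zero_le_power2[of c] by linarith
  hence K3: "K3 \<ge> 0" unfolding K3_def by simp
  have "\<bar>impulse c d k\<bar> \<le> K3 * (K1 * (K2 * q ^ k))" if "k \<ge> 1" for k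
  proof -
    have "\<bar>impulse c d k\<bar> \<le> K3 * (rate_C c d k * rate_rho c d ^ (k - 1))"
      unfolding K3_def using impulse_decay[of d k c] assms that by simp
    also have "\<dots> \<le> K3 * (K1 * (1 + real k) * rate_rho c d ^ (k - 1))"
      using K1 K3 rate_rho_nonneg[of c d] by (intro mult_left_mono mult_right_mono) auto
    also have "\<dots> \<le> K3 * (K1 * (K2 * q ^ k))"
      unfolding mult.assoc[of K1] using K1 K3 K2 that by (intro mult_left_mono) auto
    finally show ?thesis .
  qed
  hence "norm ((impulse c d k)\<^sup>2) \<le> (K3 * (K1 * K2))\<^sup>2 * (q\<^sup>2) ^ k" if "k \<ge> 1" for k
    using power_mono[OF _ abs_ge_zero, of "impulse c d k" _ 2] that
    by (fastforce simp: power_mult_distrib power_mult[symmetric] mult_ac)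
  moreover have "summable (\<lambda>k. (K3 * (K1 * K2))\<^sup>2 * (q\<^sup>2) ^ k)"
    using q by (intro summable_mult summable_geometric) (simp add: power_less_one_iff abs_square_less_1)
  ultimately show ?thesis by (rule summable_comparison_test'[rotated])
qed

text \<open>By the addition formula every term \<open>h\<^sub>k\<^sub>+\<^sub>1\<^sub>+\<^sub>j\<close> of the tail is a combination of \<open>h\<^sub>k\<^sub>+\<^sub>1\<close> and \<open>h\<^sub>k\<close> with
  coefficients \<open>h\<^sub>j\<^sub>+\<^sub>1\<close> and \<open>d h\<^sub>j\<close>, whose squares sum to at most \<open>S\<close>.\<close>
lemma impulse_tail:
  assumes "\<bar>d\<bar> < 1" "\<bar>c\<bar> < 1 - d"
  defines "S \<equiv> (\<Sum>n. (impulse c d n)\<^sup>2)"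
  shows "S - (\<Sum>j\<le>k. (impulse c d j)\<^sup>2) \<le> 2 * S * ((impulse c d k)\<^sup>2 + (impulse c d (Suc k))\<^sup>2)"
proof -
  let ?h = "impulse c d"
  have sm: "summable (\<lambda>n. (?h n)\<^sup>2)" by (rule impulse_summable[OF assms(1,2)])
  have sm1: "summable (\<lambda>n. (?h (Suc n))\<^sup>2)" using sm summable_Suc_iff[of "\<lambda>n. (?h n)\<^sup>2"] by blast
  have S1: "(\<Sum>n. (?h (Suc n))\<^sup>2) = S"
    using suminf_split_head[OF sm] by (simp add: S_def)
  have smk: "summable (\<lambda>j. (?h (j + Suc k))\<^sup>2)" using sm by (simp only: summable_iff_shift[of "\<lambda>n. (?h n)\<^sup>2" "Suc k"])
  have d: "d\<^sup>2 \<le> 1" using assms(1) by (simp add: abs_square_le_1)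
  have "S - (\<Sum>j\<le>k. (?h j)\<^sup>2) = (\<Sum>j. (?h (j + Suc k))\<^sup>2)"
    using suminf_split_initial_segment[OF sm, of "Suc k"] unfolding S_def by (simp add: lessThan_Suc_atMost)
  also have "\<dots> \<le> (\<Sum>j. 2 * (?h (Suc k))\<^sup>2 * (?h (Suc j))\<^sup>2 + 2 * (?h k)\<^sup>2 * (?h j)\<^sup>2)"
  proof (rule suminf_le[OF _ smk])
    show "summable (\<lambda>j. 2 * (?h (Suc k))\<^sup>2 * (?h (Suc j))\<^sup>2 + 2 * (?h k)\<^sup>2 * (?h j)\<^sup>2)"
      by (intro summable_add summable_mult sm sm1)
    fix j
    have "(x + d * y)\<^sup>2 \<le> 2 * x\<^sup>2 + 2 * y\<^sup>2" for x y :: real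
    proof -
      have "(x + d * y)\<^sup>2 + (x - d * y)\<^sup>2 = 2 * x\<^sup>2 + 2 * (d\<^sup>2 * y\<^sup>2)" by (simp add: power2_eq_square algebra_simps)
      moreover have "d\<^sup>2 * y\<^sup>2 \<le> 1 * y\<^sup>2" using d by (intro mult_right_mono) auto
      ultimately show ?thesis using zero_le_power2[of "x - d * y"] by linarith
    qed
    from this[of "?h (Suc k) * ?h (Suc j)" "?h k * ?h j"]
    show "(?h (j + Suc k))\<^sup>2 \<le> 2 * (?h (Suc k))\<^sup>2 * (?h (Suc j))\<^sup>2 + 2 * (?h k)\<^sup>2 * (?h j)\<^sup>2"
      using impulse_add[of c d k j] by (simp add: power_mult_distrib mult.assoc add.commute)
  qed
  also have "\<dots> = 2 * (?h (Suc k))\<^sup>2 * S + 2 * (?h k)\<^sup>2 * S"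
  proof (intro sums_unique[symmetric] sums_add sums_mult)
    show "(\<lambda>j. (?h (Suc j))\<^sup>2) sums S" using summable_sums[OF sm1] unfolding S1 .
    show "(\<lambda>j. (?h j)\<^sup>2) sums S" using summable_sums[OF sm] unfolding S_def .
  qed
  finally show ?thesis by (simp add: algebra_simps)
qed

lemma impulse_square_decay:
  assumes "\<bar>d\<bar> < 1" "\<bar>c\<bar> < 1 - d"
  shows "\<exists>K\<ge>0. \<forall>k\<ge>1. (impulse c d k)\<^sup>2 + (impulse c d (Suc k))\<^sup>2
      \<le> K * ((rate_C c d k)\<^sup>2 * rate_rho c d ^ (2 * (k - 1)))"
proof -
  define K where "K = 1 + 2 / (c\<^sup>2 + 2 * d + 2)"
  have "c\<^sup>2 + 2 * d + 2 > 0" using assms zero_le_power2[of c] by linarith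
  hence K: "K \<ge> 0" unfolding K_def by simp
  have "(impulse c d k)\<^sup>2 + (impulse c d (Suc k))\<^sup>2
      \<le> 5 * K\<^sup>2 * ((rate_C c d k)\<^sup>2 * rate_rho c d ^ (2 * (k - 1)))" if k: "1 \<le> k" for k
  proof -
    let ?B = "K * (rate_C c d k * rate_rho c d ^ (k - 1))"
    have 1: "\<bar>impulse c d k\<bar> \<le> ?B"
      unfolding K_def using impulse_decay[of d k c] assms k by simp
    have "\<bar>impulse c d (Suc k)\<bar> \<le> K * (rate_C c d (Suc k) * rate_rho c d ^ k)"
      unfolding K_def using impulse_decay[of d "Suc k" c] assms by simp
    also have "\<dots> \<le> K * ((2 * rate_C c d k) * rate_rho c d ^ (k - 1))"
      using rate_rho_less_1[OF assms] K rate_rho_nonneg rate_C_nonneg rate_C_Suc_le[OF k]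
      by (intro mult_left_mono mult_mono power_decreasing) auto
    finally have 2: "\<bar>impulse c d (Suc k)\<bar> \<le> 2 * ?B" by simp
    have "\<bar>impulse c d k\<bar>\<^sup>2 + \<bar>impulse c d (Suc k)\<bar>\<^sup>2 \<le> ?B\<^sup>2 + (2 * ?B)\<^sup>2"
      using 1 2 by (intro add_mono power_mono) auto
    thus ?thesis by (simp add: power_mult_distrib power_mult[symmetric] mult_ac)
  qed
  thus ?thesis by (intro exI[of _ "5 * K\<^sup>2"]) auto
qed

section \<open>Gaussian integrals of exponentials of squares\<close>

text \<open>The expectation of \<open>exp (a Y\<^sup>2)\<close> for a normal variable \<open>Y\<close> with mean \<open>m\<close> and variance \<open>v\<close>, where
  \<open>v = 0\<close> is the degenerate case of a constant.\<close>
definition gaussian_exp_square :: "real \<Rightarrow> real \<Rightarrow> real \<Rightarrow> ennreal" where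
  "gaussian_exp_square a m v =
     (if 2 * a * v < 1 then ennreal (exp (a * m\<^sup>2 / (1 - 2 * a * v)) / sqrt (1 - 2 * a * v)) else \<infinity>)"

lemma nn_integral_normal_density:
  assumes "0 < \<sigma>"
  shows "(\<integral>\<^sup>+x. ennreal (normal_density \<mu> \<sigma> x) \<partial>lborel) = 1"
  using prob_space.emeasure_space_1[OF prob_space_normal_density[OF assms]]
  by (simp add: emeasure_density)

lemma emeasure_lborel_halfline:
  "emeasure lborel {0::real..} = \<infinity>" "emeasure lborel {..0::real} = \<infinity>"
proof -
  have top: "x = \<infinity>" if "\<And>n. of_nat n \<le> x" for x :: ennreal
    using that ennreal_Ex_less_of_nat[of x] by (force simp: not_le[symmetric] less_top)
  have "of_nat n \<le> emeasure lborel {0::real..}" for n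
    using emeasure_mono[of "{0..real n}" "{0..}" lborel] by (simp add: ennreal_of_nat_eq_real_of_nat)
  thus "emeasure lborel {0::real..} = \<infinity>" by (rule top)
  have "of_nat n \<le> emeasure lborel {..0::real}" for n
    using emeasure_mono[of "{- real n..0}" "{..0}" lborel] by (simp add: ennreal_of_nat_eq_real_of_nat)
  thus "emeasure lborel {..0::real} = \<infinity>" by (rule top)
qed

text \<open>Completing the square leaves a multiple of another normal density while \<open>2 a l\<^sup>2 \<sigma>\<^sup>2 < 1\<close>. Beyond
  that threshold the quadratic part of the exponent is nonnegative, and on the half line where the
  linear part is nonnegative too the integrand is bounded below by a positive constant.\<close>
lemma nn_integral_normal_exp_square:
  assumes "a > 0" "\<sigma> > 0"
  shows "(\<integral>\<^sup>+x. ennreal (exp (a * (y + l * x)\<^sup>2) * normal_density 0 \<sigma> x) \<partial>lborel)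
    = gaussian_exp_square a y (l\<^sup>2 * \<sigma>\<^sup>2)"
proof (cases "2 * a * (l\<^sup>2 * \<sigma>\<^sup>2) < 1")
  case True
  define D where "D = 1 - 2 * a * (l\<^sup>2 * \<sigma>\<^sup>2)"
  have D: "D > 0" using True unfolding D_def by simp
  define m where "m = 2 * a * y * l * \<sigma>\<^sup>2 / D"
  define s where "s = \<sigma> / sqrt D"
  have s: "s > 0" "s\<^sup>2 = \<sigma>\<^sup>2 / D" using D assms unfolding s_def by (auto simp: power_divide)
  have ex: "a * (y + l * x)\<^sup>2 + - (x - 0)\<^sup>2 / (2 * \<sigma>\<^sup>2) = a * y\<^sup>2 / D + - (x - m)\<^sup>2 / (2 * s\<^sup>2)" for x
  proof -
    have Dm: "D * m = 2 * a * y * l * \<sigma>\<^sup>2" using D unfolding m_def by simp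
    have "2 * \<sigma>\<^sup>2 * D * (a * (y + l * x)\<^sup>2) - D * x\<^sup>2 = 2 * \<sigma>\<^sup>2 * (a * y\<^sup>2) - (D * x - D * m)\<^sup>2"
      unfolding Dm unfolding D_def by (simp add: power2_eq_square algebra_simps)
    moreover have "(D * x - D * m)\<^sup>2 = D\<^sup>2 * (x - m)\<^sup>2" by (simp add: power2_eq_square algebra_simps)
    ultimately have "2 * \<sigma>\<^sup>2 * D * (a * (y + l * x)\<^sup>2) - D * x\<^sup>2 = 2 * \<sigma>\<^sup>2 * (a * y\<^sup>2) - D\<^sup>2 * (x - m)\<^sup>2" by simp
    moreover have "P + - X / (2 * v) = Y / D + - M / (2 * (v / D))"
      if "2 * v * D * P - D * X = 2 * v * Y - D\<^sup>2 * M" "v > 0" for P X Y M v :: real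
    proof -
      have "2 * v * D * (P + - X / (2 * v)) = 2 * v * D * P - D * X"
        using that(2) by (simp add: field_simps)
      also have "\<dots> = 2 * v * D * (Y / D + - M / (2 * (v / D)))"
        unfolding that(1) using that(2) D by (simp add: field_simps power2_eq_square)
      finally show ?thesis using that(2) D by simp
    qed
    ultimately show ?thesis unfolding s(2) diff_0_right using assms by simp
  qed
  have nrm: "1 / sqrt (2 * pi * \<sigma>\<^sup>2) = 1 / sqrt D * (1 / sqrt (2 * pi * s\<^sup>2))"
    unfolding s(2) using D by (simp add: real_sqrt_mult real_sqrt_divide)
  have "exp (a * (y + l * x)\<^sup>2) * normal_density 0 \<sigma> x
      = exp (a * y\<^sup>2 / D) / sqrt D * normal_density m s x" for x
  proof -
    have "exp (a * (y + l * x)\<^sup>2) * normal_density 0 \<sigma> x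
      = 1 / sqrt (2 * pi * \<sigma>\<^sup>2) * exp (a * (y + l * x)\<^sup>2 + - (x - 0)\<^sup>2 / (2 * \<sigma>\<^sup>2))"
      unfolding normal_density_def exp_add by simp
    also have "\<dots> = exp (a * y\<^sup>2 / D) / sqrt D * normal_density m s x"
      unfolding normal_density_def ex exp_add nrm by simp
    finally show ?thesis .
  qed
  hence "(\<integral>\<^sup>+x. ennreal (exp (a * (y + l * x)\<^sup>2) * normal_density 0 \<sigma> x) \<partial>lborel)
    = (\<integral>\<^sup>+x. ennreal (exp (a * y\<^sup>2 / D) / sqrt D) * ennreal (normal_density m s x) \<partial>lborel)"
    using D by (simp add: ennreal_mult[symmetric])
  also have "\<dots> = ennreal (exp (a * y\<^sup>2 / D) / sqrt D)"
    by (subst nn_integral_cmult) (simp_all add: nn_integral_normal_density s)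
  finally show ?thesis using True unfolding gaussian_exp_square_def D_def by simp
next
  case False
  define K where "K = exp (a * y\<^sup>2) / sqrt (2 * pi * \<sigma>\<^sup>2)"
  have K: "K > 0" unfolding K_def using assms by simp
  define A where "A = (if y * l \<ge> 0 then {0::real..} else {..0})"
  have A: "A \<in> sets lborel" "emeasure lborel A = \<infinity>" unfolding A_def by (auto simp: emeasure_lborel_halfline)
  have le: "K \<le> exp (a * (y + l * x)\<^sup>2) * normal_density 0 \<sigma> x" if "x \<in> A" for x
  proof -
    have "0 \<le> (y * l) * x"
    proof (cases "y * l \<ge> 0")
      case True
      with that show ?thesis using mult_nonneg_nonneg[of "y * l" x] unfolding A_def by simp
    next
      case False
      with that show ?thesis using mult_nonpos_nonpos[of "y * l" x] unfolding A_def by simp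
    qed
    hence "0 \<le> 2 * a * (y * l * x)" using assms by simp
    moreover have "x\<^sup>2 / (2 * \<sigma>\<^sup>2) \<le> a * (l * x)\<^sup>2"
    proof -
      have "1 * x\<^sup>2 \<le> 2 * a * (l\<^sup>2 * \<sigma>\<^sup>2) * x\<^sup>2" using False by (intro mult_right_mono) auto
      thus ?thesis using assms by (simp add: field_simps)
    qed
    moreover have "a * (y + l * x)\<^sup>2 = a * y\<^sup>2 + 2 * a * (y * l * x) + a * (l * x)\<^sup>2"
      by (simp add: power2_eq_square algebra_simps)
    ultimately have "a * y\<^sup>2 \<le> a * (y + l * x)\<^sup>2 + - x\<^sup>2 / (2 * \<sigma>\<^sup>2)" by simp
    hence "K \<le> exp (a * (y + l * x)\<^sup>2 + - x\<^sup>2 / (2 * \<sigma>\<^sup>2)) / sqrt (2 * pi * \<sigma>\<^sup>2)"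
      unfolding K_def by (intro divide_right_mono) auto
    thus ?thesis unfolding normal_density_def exp_add by simp
  qed
  have "\<infinity> = (\<integral>\<^sup>+x. ennreal K * indicator A x \<partial>lborel)"
    using A K by (simp add: nn_integral_cmult_indicator ennreal_mult_top)
  also have "\<dots> \<le> (\<integral>\<^sup>+x. ennreal (exp (a * (y + l * x)\<^sup>2) * normal_density 0 \<sigma> x) \<partial>lborel)"
    by (intro nn_integral_mono) (auto split: split_indicator intro!: ennreal_leI le)
  finally show ?thesis using False by (simp add: gaussian_exp_square_def top_unique)
qed

text \<open>Integrating out a component of variance \<open>v2\<close> turns the weight \<open>a\<close> into \<open>a / (1 - 2 a v2)\<close>; this is
  the semigroup law that composes successive noise steps.\<close>
lemma gaussian_exp_square_add:
  assumes "2 * a * v2 < 1"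
  shows "ennreal (1 / sqrt (1 - 2 * a * v2)) * gaussian_exp_square (a / (1 - 2 * a * v2)) m v1
    = gaussian_exp_square a m (v1 + v2)"
proof -
  define D where "D = 1 - 2 * a * v2"
  have D: "D > 0" using assms unfolding D_def by simp
  have eq: "1 - 2 * (a / D) * v1 = (1 - 2 * a * (v1 + v2)) / D"
    using D unfolding D_def by (simp add: field_simps)
  have iff: "2 * (a / D) * v1 < 1 \<longleftrightarrow> 2 * a * (v1 + v2) < 1"
    using D eq by (metis diff_gt_0_iff_gt zero_less_divide_iff order.asym)
  show ?thesis
  proof (cases "2 * a * (v1 + v2) < 1")
    case True
    define E where "E = 1 - 2 * a * (v1 + v2)"
    have E: "E > 0" using True unfolding E_def by simp
    have "1 / sqrt D * (exp (a / D * m\<^sup>2 / (E / D)) / sqrt (E / D)) = exp (a * m\<^sup>2 / E) / sqrt E"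
      using D E by (simp add: real_sqrt_divide)
    moreover have "gaussian_exp_square (a / D) m v1 = ennreal (exp (a / D * m\<^sup>2 / (E / D)) / sqrt (E / D))"
      unfolding gaussian_exp_square_def eq E_def using True iff by simp
    ultimately show ?thesis using True D E
      unfolding D_def[symmetric] gaussian_exp_square_def[of a m] E_def[symmetric]
      by (simp add: ennreal_mult[symmetric])
  next
    case False
    thus ?thesis using D iff unfolding D_def[symmetric] gaussian_exp_square_def
      by (simp add: ennreal_mult_top)
  qed
qed

lemma gaussian_exp_square_ge_1:
  assumes "a > 0" "v \<ge> 0"
  shows "1 \<le> gaussian_exp_square a m v"
proof (cases "2 * a * v < 1")
  case True
  have "1 \<le> exp (a * m\<^sup>2 / (1 - 2 * a * v))" using assms True by simp
  moreover have "sqrt (1 - 2 * a * v) \<le> 1" "0 < sqrt (1 - 2 * a * v)" using assms True by auto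
  ultimately have "sqrt (1 - 2 * a * v) \<le> exp (a * m\<^sup>2 / (1 - 2 * a * v))" "0 < sqrt (1 - 2 * a * v)"
    by linarith+
  hence "1 \<le> exp (a * m\<^sup>2 / (1 - 2 * a * v)) / sqrt (1 - 2 * a * v)" by simp
  thus ?thesis using True unfolding gaussian_exp_square_def by simp
qed (simp add: gaussian_exp_square_def)

lemma nn_integral_lborel_translate:
  fixes f :: "'a::euclidean_space \<Rightarrow> ennreal"
  assumes [measurable]: "f \<in> borel_measurable borel"
  shows "(\<integral>\<^sup>+x. f (c + x) \<partial>lborel) = (\<integral>\<^sup>+x. f x \<partial>lborel)"
proof -
  have "(\<integral>\<^sup>+x. f (c + x) \<partial>lborel) = (\<integral>\<^sup>+x. f x \<partial>distr lborel borel ((+) c))"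
    by (rule nn_integral_distr[symmetric]) measurable
  thus ?thesis by (simp add: lborel_distr_plus)
qed

lemma norm_orthogonal_matrix_vector:
  fixes U :: "real^'d^'d"
  assumes "orthogonal_matrix U"
  shows "norm (U *v x) = norm x"
  using assms by (metis orthogonal_transformation_matrix orthogonal_transformation_norm
      matrix_of_matrix_vector_mul matrix_vector_mul_linear)

lemma measurable_matrix_vector_mul [measurable]:
  fixes U :: "real^'d^'d"
  shows "(*v) U \<in> borel_measurable borel"
  by (intro borel_measurable_continuous_onI linear_continuous_on matrix_vector_mul_bounded_linear)

text \<open>Invariance follows from translation invariance alone. Weight the integral of \<open>f \<circ> U\<close> with the
  indicator of the unit ball, shift by the preimage of the ball variable, exchange the integrals,
  and shift back: since the ball is invariant under \<open>U\<close>, the weight is recovered next to the integral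
  of \<open>f\<close>. The weight is finite and positive and cancels.\<close>
lemma nn_integral_lborel_orthogonal_matrix:
  fixes U :: "real^'d^'d" and f :: "real^'d \<Rightarrow> ennreal"
  assumes U: "orthogonal_matrix U" and f[measurable]: "f \<in> borel_measurable borel"
  shows "(\<integral>\<^sup>+x. f (U *v x) \<partial>lborel) = (\<integral>\<^sup>+x. f x \<partial>lborel)"
proof -
  define V where "V = transpose U"
  have UV: "U *v (V *v x) = x" for x
    using U unfolding orthogonal_matrix_def V_def
    by (simp add: matrix_vector_mul_assoc del: transpose_matrix_vector)
  let ?g = "indicator (ball 0 1) :: real^'d \<Rightarrow> ennreal"
  have g[measurable]: "?g \<in> borel_measurable borel"
    by (intro borel_measurable_indicator) auto
  define I where "I = (\<integral>\<^sup>+y. ?g y \<partial>(lborel :: (real^'d) measure))"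
  have I: "I = emeasure lborel (ball 0 1 :: (real^'d) set)"
    unfolding I_def by simp
  have "I \<noteq> \<infinity>" unfolding I using emeasure_lborel_ball_finite[of 0 1] by (auto simp: less_top)
  have "I \<noteq> 0" unfolding I
    by (metis content_ball_pos emeasure_eq_measure2 measure_def enn2real_0 less_irrefl zero_less_one)
  have "I * (\<integral>\<^sup>+x. f (U *v x) \<partial>lborel) = (\<integral>\<^sup>+y. ?g y * (\<integral>\<^sup>+x. f (U *v x) \<partial>lborel) \<partial>lborel)"
    unfolding I_def by (rule nn_integral_multc[symmetric]) simp
  also have "\<dots> = (\<integral>\<^sup>+y. ?g y * (\<integral>\<^sup>+x. f (U *v (V *v y + x)) \<partial>lborel) \<partial>lborel)"
    by (subst nn_integral_lborel_translate[of "\<lambda>x. f (U *v x)"]) auto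
  also have "\<dots> = (\<integral>\<^sup>+y. (\<integral>\<^sup>+x. ?g y * f (y + U *v x) \<partial>lborel) \<partial>lborel)"
    by (subst nn_integral_cmult) (auto simp: matrix_vector_right_distrib UV)
  also have "\<dots> = (\<integral>\<^sup>+x. (\<integral>\<^sup>+y. ?g y * f (y + U *v x) \<partial>lborel) \<partial>lborel)"
    by (rule lborel_pair.Fubini') measurable
  also have "\<dots> = (\<integral>\<^sup>+x. (\<integral>\<^sup>+y. ?g (- (U *v x) + y) * f (- (U *v x) + y + U *v x) \<partial>lborel) \<partial>lborel)"
    by (subst nn_integral_lborel_translate[of "\<lambda>y. ?g y * f (y + U *v _)"]) auto
  also have "\<dots> = (\<integral>\<^sup>+x. (\<integral>\<^sup>+y. ?g (- (U *v x) + y) * f y \<partial>lborel) \<partial>lborel)" by simp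
  also have "\<dots> = (\<integral>\<^sup>+y. (\<integral>\<^sup>+x. ?g (- (U *v x) + y) * f y \<partial>lborel) \<partial>lborel)"
    by (rule lborel_pair.Fubini') measurable
  also have "\<dots> = (\<integral>\<^sup>+y. (\<integral>\<^sup>+x. ?g (- (V *v y) + x) \<partial>lborel) * f y \<partial>lborel)"
  proof (rule nn_integral_cong)
    fix y
    \<comment> \<open>The arguments are mapped to each other by \<open>U\<close> and a change of sign, so their norms agree.\<close>
    have "?g (- (U *v x) + y) = ?g (- (V *v y) + x)" for x
    proof -
      have "U *v (- (V *v y) + x) = - (- (U *v x) + y)"
        using matrix_vector_mult_diff_distrib[of U x "V *v y"] by (simp add: UV)
      hence "norm (- (U *v x) + y) = norm (U *v (- (V *v y) + x))"
        by (simp only: norm_minus_cancel)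
      thus
       ?thesis unfolding norm_orthogonal_matrix_vector[OF U] by (simp add: indicator_def)
    qed
    thus "(\<integral>\<^sup>+x. ?g (- (U *v x) + y) * f y \<partial>lborel) = (\<integral>\<^sup>+x. ?g (- (V *v y) + x) \<partial>lborel) * f y"
      by (simp add: nn_integral_multc)
  qed
  also have "\<dots> = I * (\<integral>\<^sup>+x. f x \<partial>lborel)"
    unfolding nn_integral_lborel_translate[OF g] I_def by (rule nn_integral_cmult) simp
  finally show ?thesis using \<open>I \<noteq> 0\<close> \<open>I \<noteq> \<infinity>\<close> by (simp add: ennreal_mult_cancel_left)
qed

lemma isotropic_gaussian_density_prod:
  fixes x :: "real^'d"
  assumes "\<sigma> > 0"
  shows "isotropic_gaussian_density \<sigma> x = (\<Prod>j\<in>UNIV. normal_density 0 \<sigma> (x $ j))"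
proof -
  have "(norm x)\<^sup>2 = (\<Sum>j\<in>UNIV. (x $ j)\<^sup>2)"
    by (simp only: power2_norm_eq_inner) (simp add: inner_vec_def power2_eq_square)
  hence "- (norm x)\<^sup>2 / (2 * \<sigma>\<^sup>2) = (\<Sum>j\<in>UNIV. - (x $ j)\<^sup>2 / (2 * \<sigma>\<^sup>2))"
    by (simp add: sum_divide_distrib sum_negf)
  hence "exp (- (norm x)\<^sup>2 / (2 * \<sigma>\<^sup>2)) = (\<Prod>j\<in>UNIV. exp (- (x $ j)\<^sup>2 / (2 * \<sigma>\<^sup>2)))"
    by (simp add: exp_sum)
  thus ?thesis unfolding isotropic_gaussian_density_def normal_density_def
    by (simp add: prod_dividef)
qed

lemma nn_integral_vec_prod:
  fixes g :: "'d::finite \<Rightarrow> real \<Rightarrow> real"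
  assumes [measurable]: "\<And>j. g j \<in> borel_measurable borel" and nn: "\<And>j t. 0 \<le> g j t"
  shows "(\<integral>\<^sup>+x. ennreal (\<Prod>j\<in>UNIV. g j (x $ j)) \<partial>(lborel :: (real^'d) measure))
    = (\<Prod>j\<in>UNIV. \<integral>\<^sup>+t. ennreal (g j t) \<partial>lborel)"
proof -
  define ix where "ix b = (THE j. b = axis j (1::real))" for b :: "real^'d"
  have ix: "ix (axis j 1) = j" for j unfolding ix_def by (auto simp: axis_eq_axis)
  have B: "(Basis :: (real^'d) set) = range (\<lambda>j. axis j 1)" by (auto simp: Basis_vec_def)
  have inj: "inj (\<lambda>j::'d. axis j (1::real))" by (auto simp: inj_def axis_eq_axis)
  have re: "(\<Prod>b\<in>(Basis :: (real^'d) set). G b) = (\<Prod>j\<in>UNIV. G (axis j 1))" for G :: "real^'d \<Rightarrow> 'b::comm_monoid_mult"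
    unfolding B by (simp add: prod.reindex[OF inj])
  have "(\<integral>\<^sup>+x. (\<Prod>b\<in>Basis. ennreal (g (ix b) (x \<bullet> b))) \<partial>(lborel :: (real^'d) measure))
    = (\<Prod>b\<in>(Basis :: (real^'d) set). \<integral>\<^sup>+t. ennreal (g (ix b) t) \<partial>lborel)"
    by (rule nn_integral_lborel_prod) (auto simp: nn)
  thus ?thesis unfolding re by (simp add: ix inner_axis prod_ennreal nn)
qed

text \<open>The isotropic density is a function of the norm and a product over coordinates, so in rotated
  coordinates the noise still has independent normal components.\<close>
lemma nn_integral_rotated_gaussian_prod:
  fixes U :: "real^'d^'d" and g :: "'d \<Rightarrow> real \<Rightarrow> real"
  assumes U: "orthogonal_matrix U" and \<sigma>: "\<sigma> > 0"
    and [measurable]: "\<And>j. g j \<in> borel_measurable borel" and nn: "\<And>j t. 0 \<le> g j t"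
  shows "(\<integral>\<^sup>+x. ennreal ((\<Prod>j\<in>UNIV. g j ((U *v x) $ j)) * isotropic_gaussian_density \<sigma> x) \<partial>lborel)
    = (\<Prod>j\<in>UNIV. \<integral>\<^sup>+t. ennreal (g j t * normal_density 0 \<sigma> t) \<partial>lborel)"
proof -
  have [measurable]: "(\<lambda>x::real^'d. x $ j) \<in> borel_measurable borel" for j
    by (intro borel_measurable_continuous_onI continuous_intros)
  let ?F = "\<lambda>x::real^'d. ennreal (\<Prod>j\<in>UNIV. g j (x $ j) * normal_density 0 \<sigma> (x $ j))"
  have "isotropic_gaussian_density \<sigma> x = isotropic_gaussian_density \<sigma> (U *v x)" for x
    unfolding isotropic_gaussian_density_def norm_orthogonal_matrix_vector[OF U] ..
  hence "(\<integral>\<^sup>+x. ennreal ((\<Prod>j\<in>UNIV. g j ((U *v x) $ j)) * isotropic_gaussian_density \<sigma> x) \<partial>lborel)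
    = (\<integral>\<^sup>+x. ?F (U *v x) \<partial>lborel)"
    by (simp add: isotropic_gaussian_density_prod[OF \<sigma>] prod.distrib)
  also have "\<dots> = (\<integral>\<^sup>+x. ?F x \<partial>lborel)"
    by (rule nn_integral_lborel_orthogonal_matrix[OF U]) measurable
  also have "\<dots> = (\<Prod>j\<in>UNIV. \<integral>\<^sup>+t. ennreal (g j t * normal_density 0 \<sigma> t) \<partial>lborel)"
    by (rule nn_integral_vec_prod) (auto simp: nn)
  finally show ?thesis .
qed

text \<open>The product formula for preimages identifies the joint law of the pair as a product measure,
  for components that may take values in different spaces.\<close>
lemma (in prob_space) nn_integral_indep_pair:
  fixes Z :: "'a \<Rightarrow> 'b::second_countable_topology" and W :: "'a \<Rightarrow> 'c::euclidean_space"
  assumes rv[measurable]: "Z \<in> borel_measurable M"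
    and ind: "\<And>A B. A \<in> sets borel \<Longrightarrow> B \<in> sets borel \<Longrightarrow>
      prob (Z -` A \<inter> space M \<inter> (W -` B \<inter> space M)) = prob (Z -` A \<inter> space M) * prob (W -` B \<inter> space M)"
    and W: "distributed M lborel W \<phi>"
    and F[measurable]: "F \<in> borel_measurable borel"
  shows "(\<integral>\<^sup>+\<omega>. F (Z \<omega>, W \<omega>) \<partial>M) = (\<integral>\<^sup>+\<omega>. (\<integral>\<^sup>+x. \<phi> x * F (Z \<omega>, x) \<partial>lborel) \<partial>M)"
proof -
  have [measurable]: "W \<in> borel_measurable M"
    using distributed_measurable[OF W] by simp
  have F2[measurable]: "F \<in> borel_measurable (borel \<Otimes>\<^sub>M borel)" unfolding borel_prod by (rule F)
  have \<phi>[measurable]: "\<phi> \<in> borel_measurable borel"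
    using distributed_borel_measurable[OF W] by simp
  have dW: "distr M borel W = density lborel \<phi>"
    using distributed_distr_eq_density[OF W] by (simp cong: distr_cong)
  interpret W: prob_space "distr M borel W" by (rule prob_space_distr) simp
  interpret Z: prob_space "distr M borel Z" by (rule prob_space_distr) simp
  have "(\<integral>\<^sup>+\<omega>. F (Z \<omega>, W \<omega>) \<partial>M) = (\<integral>\<^sup>+z. F z \<partial>distr M (borel \<Otimes>\<^sub>M borel) (\<lambda>\<omega>. (Z \<omega>, W \<omega>)))"
    by (rule nn_integral_distr[symmetric]) measurable
  also have "distr M (borel \<Otimes>\<^sub>M borel) (\<lambda>\<omega>. (Z \<omega>, W \<omega>)) = distr M borel Z \<Otimes>\<^sub>M distr M borel W"
  proof (rule pair_measure_eqI[symmetric])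
    fix A B assume "A \<in> sets (distr M borel Z)" "B \<in> sets (distr M borel W)"
    hence AB[measurable]: "A \<in> sets borel" "B \<in> sets borel" by auto
    have "(\<lambda>\<omega>. (Z \<omega>, W \<omega>)) -` (A \<times> B) \<inter> space M = Z -` A \<inter> space M \<inter> (W -` B \<inter> space M)" by auto
    thus "emeasure (distr M borel Z) A * emeasure (distr M borel W) B
      = emeasure (distr M (borel \<Otimes>\<^sub>M borel) (\<lambda>\<omega>. (Z \<omega>, W \<omega>))) (A \<times> B)"
      using ind[OF AB] by (simp add: emeasure_distr emeasure_eq_measure ennreal_mult)
  qed (simp_all add: W.sigma_finite_measure_axioms Z.sigma_finite_measure_axioms cong: sets_pair_measure_cong)
  also have "(\<integral>\<^sup>+z. F z \<partial>(distr M borel Z \<Otimes>\<^sub>M distr M borel W))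
    = (\<integral>\<^sup>+z. \<integral>\<^sup>+x. F (z, x) \<partial>distr M borel W \<partial>distr M borel Z)"
    by (rule W.nn_integral_fst[symmetric]) simp
  also have "\<dots> = (\<integral>\<^sup>+z. \<integral>\<^sup>+x. \<phi> x * F (z, x) \<partial>lborel \<partial>distr M borel Z)"
    unfolding dW by (intro nn_integral_cong nn_integral_density) auto
  also have "\<dots> = (\<integral>\<^sup>+\<omega>. (\<integral>\<^sup>+x. \<phi> x * F (Z \<omega>, x) \<partial>lborel) \<partial>M)"
    by (rule nn_integral_distr) auto
  finally show ?thesis .
qed

lemma prod_ennreal_eq_top:
  fixes F :: "'i::finite \<Rightarrow> ennreal"
  assumes "F i = \<infinity>" "\<And>j. F j \<noteq> 0"
  shows "(\<Prod>j\<in>UNIV. F j) = \<infinity>"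
proof -
  have "(\<Prod>j\<in>UNIV - {i}. F j) \<noteq> 0" using assms(2) by simp
  thus ?thesis using assms(1) by (subst prod.remove[of UNIV i]) (simp_all add: ennreal_top_mult)
qed

lemma prod_ge_factor_ennreal:
  fixes F :: "'i::finite \<Rightarrow> ennreal"
  assumes "\<And>j. 1 \<le> F j"
  shows "F i \<le> (\<Prod>j\<in>UNIV. F j)"
proof -
  have "F i * 1 \<le> F i * (\<Prod>j\<in>UNIV - {i}. F j)"
    using assms by (intro mult_left_mono prod_ge_1) auto
  thus ?thesis by (subst prod.remove[of UNIV i]) simp_all
qed

section \<open>The exponential moment of the objective gap\<close>

lemma gradient_quadratic:
  fixes Q :: "real^'d^'d"
  assumes "transpose Q = Q"
  shows "gradient (quadratic Q p r) x = Q *v x + p"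
proof -
  note sa = symmetric_matrix_inner[OF assms]
  have "((\<lambda>y. 1/2 * (y \<bullet> (Q *v y)) + p \<bullet> y + r) has_derivative
      (\<lambda>h. 1/2 * (x \<bullet> (Q *v h) + h \<bullet> (Q *v x)) + p \<bullet> h)) (at x)"
    by (auto intro!: derivative_eq_intros bounded_linear.has_derivative[OF matrix_vector_mul_bounded_linear])
  moreover have "(\<lambda>h. 1/2 * (x \<bullet> (Q *v h) + h \<bullet> (Q *v x)) + p \<bullet> h) = (\<lambda>h. h \<bullet> (Q *v x + p))"
    using sa by (auto simp: inner_add_right inner_commute)
  ultimately have D: "GDERIV (quadratic Q p r) x :> (Q *v x + p)"
    unfolding gderiv_def quadratic_def by simp
  show ?thesis unfolding gradient_def
  proof (rule the_equality)
    show "GDERIV (quadratic Q p r) x :> Q *v x + p" by (rule D)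
  next
    fix g assume "GDERIV (quadratic Q p r) x :> g"
    with D have "(\<lambda>h. h \<bullet> (Q *v x + p)) = (\<lambda>h. h \<bullet> g)"
      unfolding gderiv_def by (rule has_derivative_unique)
    hence "h \<bullet> g = h \<bullet> (Q *v x + p)" for h by metis
    thus "g = Q *v x + p" by (metis inner_commute vector_eq_ldot)
  qed
qed

text \<open>The linear terms cancel at a stationary point, and \<open>U\<close> preserves the inner product.\<close>
lemma quadratic_gap_coordinates:
  fixes Q U :: "real^'d^'d"
  assumes sym: "transpose Q = Q" and U: "orthogonal_matrix U"
    and diag: "\<And>x j. (U *v (Q *v x)) $ j = e j * (U *v x) $ j"
    and stationary: "Q *v xstar + p = 0"
  shows "quadratic Q p r y - quadratic Q p r xstar = 1/2 * (\<Sum>j\<in>UNIV. e j * ((U *v (y - xstar)) $ j)\<^sup>2)"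
proof -
  note sa = symmetric_matrix_inner[OF sym]
  have p: "p = - (Q *v xstar)" using stationary by (simp add: eq_neg_iff_add_eq_0 add.commute)
  have "quadratic Q p r y - quadratic Q p r xstar = 1/2 * ((y - xstar) \<bullet> (Q *v (y - xstar)))"
    unfolding quadratic_def p using sa[of xstar y] sa[of xstar xstar]
    by (simp add: matrix_vector_mult_diff_distrib inner_diff_left inner_diff_right inner_commute algebra_simps)
  also have "(y - xstar) \<bullet> (Q *v (y - xstar)) = (U *v (y - xstar)) \<bullet> (U *v (Q *v (y - xstar)))"
  proof -
    have "orthogonal_transformation ((*v) U)" using U by (simp add: orthogonal_transformation_matrix)
    thus ?thesis unfolding orthogonal_transformation_def by simp
  qed
  also have "\<dots> = (\<Sum>j\<in>UNIV. e j * ((U *v (y - xstar)) $ j)\<^sup>2)"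
    by (simp add: inner_vec_def diag power2_eq_square mult_ac)
  finally show ?thesis .
qed

text \<open>The noisy iteration for a quadratic objective together with a diagonalization of \<open>Q\<close>. The
  stationary point is a parameter, so that all formulas are in terms of the error \<open>x\<^sub>k - x\<^sub>*\<close>.\<close>
locale gmm_process = prob_space M
  for M :: "'w measure" +
  fixes Q U :: "real^'d^'d" and e :: "'d \<Rightarrow> real" and p xstar x0 xm1 :: "real^'d"
    and r \<alpha> \<beta> \<gamma> \<sigma> :: real and w :: "nat \<Rightarrow> 'w \<Rightarrow> real^'d"
  assumes sym: "transpose Q = Q"
    and U: "orthogonal_matrix U" and diag: "\<And>x j. (U *v (Q *v x)) $ j = e j * (U *v x) $ j"
    and stationary: "Q *v xstar + p = 0"
    and \<sigma>: "\<sigma> > 0"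
    and noise: "gaussian_noise M \<sigma> (\<lambda>k \<omega>. gmm (quadratic Q p r) \<alpha> \<beta> \<gamma> x0 xm1 (\<lambda>j. w j \<omega>) k) w"
begin

definition X :: "nat \<Rightarrow> 'w \<Rightarrow> real^'d" where
  "X k \<omega> = gmm (quadratic Q p r) \<alpha> \<beta> \<gamma> x0 xm1 (\<lambda>j. w j \<omega>) k"

definition Z :: "nat \<Rightarrow> 'w \<Rightarrow> (real^'d) \<times> (real^'d)" where
  "Z k \<omega> = gmm_state (quadratic Q p r) \<alpha> \<beta> \<gamma> x0 xm1 (\<lambda>j. w j \<omega>) k"

abbreviation coord :: "real^'d \<Rightarrow> 'd \<Rightarrow> real" where
  "coord y j \<equiv> (U *v (y - xstar)) $ j"

abbreviation c :: "'d \<Rightarrow> real" where "c j \<equiv> gmm_c \<alpha> \<beta> \<gamma> (e j)"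
abbreviation d :: "'d \<Rightarrow> real" where "d j \<equiv> gmm_d \<alpha> \<beta> \<gamma> (e j)"

lemma fst_Z: "fst (Z k \<omega>) = X k \<omega>"
  unfolding Z_def X_def gmm_def ..

lemma Z_0: "Z 0 \<omega> = (x0, xm1)"
  unfolding Z_def by simp

lemma Z_eq: "Z k \<omega> = (X k \<omega>, if k = 0 then xm1 else X (k - 1) \<omega>)"
  by (cases k) (auto simp: Z_def X_def gmm_def Let_def split: prod.split)

lemma coord_step:
  "coord (fst (Z (Suc k) \<omega>)) j = c j * coord (fst (Z k \<omega>)) j + d j * coord (snd (Z k \<omega>)) j
     - \<alpha> * (U *v w (Suc k) \<omega>) $ j"
  "snd (Z (Suc k) \<omega>) = fst (Z k \<omega>)"
proof -
  obtain y y' where y: "Z k \<omega> = (y, y')" by (cases "Z k \<omega>")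
  define v where "v = (1 + \<gamma>) *\<^sub>R y - \<gamma> *\<^sub>R y'"
  have "gradient (quadratic Q p r) v = Q *v (v - xstar)"
    using stationary unfolding gradient_quadratic[OF sym]
    by (simp add: matrix_vector_mult_diff_distrib) (metis add_diff_cancel diff_0 uminus_add_conv_diff diff_minus_eq_add)
  hence Zs: "Z (Suc k) \<omega> = ((1 + \<beta>) *\<^sub>R y - \<beta> *\<^sub>R y' - \<alpha> *\<^sub>R (Q *v (v - xstar) + w (Suc k) \<omega>), y)"
    using y unfolding Z_def by (simp add: v_def)
  have vs: "v - xstar = (1 + \<gamma>) *\<^sub>R (y - xstar) - \<gamma> *\<^sub>R (y' - xstar)"
    unfolding v_def by (simp add: algebra_simps)
  have "fst (Z (Suc k) \<omega>) - xstar = (1 + \<beta>) *\<^sub>R (y - xstar) - \<beta> *\<^sub>R (y' - xstar)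
      - \<alpha> *\<^sub>R (Q *v (v - xstar)) - \<alpha> *\<^sub>R w (Suc k) \<omega>"
    unfolding Zs by (simp add: algebra_simps)
  hence "coord (fst (Z (Suc k) \<omega>)) j = (1 + \<beta>) * coord y j - \<beta> * coord y' j
      - \<alpha> * (e j * ((1 + \<gamma>) * coord y j - \<gamma> * coord y' j)) - \<alpha> * (U *v w (Suc k) \<omega>) $ j"
    by (simp add: matrix_vector_mult_diff_distrib[of U] matrix_vector_mult_scaleR diag vs)
  thus "coord (fst (Z (Suc k) \<omega>)) j = c j * coord (fst (Z k \<omega>)) j + d j * coord (snd (Z k \<omega>)) j
     - \<alpha> * (U *v w (Suc k) \<omega>) $ j"
    unfolding y gmm_c_def gmm_d_def by (simp add: algebra_simps)
  show "snd (Z (Suc k) \<omega>) = fst (Z k \<omega>)" unfolding Zs y by simp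
qed

lemma noise_distributed: "distributed M lborel (w (Suc k)) (\<lambda>x. ennreal (isotropic_gaussian_density \<sigma> x))"
  using noise unfolding gaussian_noise_def by blast

lemma noise_indep: "indep_set (generated_events M X {..k}) (generated_events M w {Suc k})"
  using noise unfolding gaussian_noise_def X_def[abs_def] by blast

text \<open>The state consists of two iterates up to time \<open>k\<close>, or of an iterate and the deterministic vector
  \<open>xm1\<close>, and is therefore independent of the next noise vector.\<close>
lemma Z_preimage:
  assumes "A \<in> sets borel"
  shows "Z k -` A \<inter> space M \<in> generated_events M X {..k}"
proof -
  define G where "G = (\<Union>i\<in>{..k}. {X i -` A \<inter> space M | A. A \<in> sets borel})"
  define N where "N = sigma (space M) G"
  have G: "G \<subseteq> Pow (space M)" unfolding G_def by auto
  have sN: "sets N = generated_events M X {..k}" "space N = space M"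
    unfolding N_def generated_events_def G_def[symmetric] using G by (simp_all add: sets_measure_of space_measure_of)
  have [measurable]: "X i \<in> borel_measurable N" if "i \<le> k" for i
  proof (rule measurableI)
    fix A :: "(real^'d) set" assume "A \<in> sets borel"
    hence "X i -` A \<inter> space M \<in> G" unfolding G_def using that by blast
    thus "X i -` A \<inter> space N \<in> sets N" unfolding sN(2) unfolding N_def using G by auto
  qed simp
  have "Z k = (\<lambda>\<omega>. (X k \<omega>, if k = 0 then xm1 else X (k - 1) \<omega>))" using Z_eq by auto
  also have "\<dots> \<in> borel_measurable N"
    by (intro borel_measurable_Pair) (cases "k = 0"; simp)+
  finally show ?thesis using measurable_sets[of "Z k" N borel A] assms unfolding sN by simp
qed

lemma Z_measurable [measurable]: "Z k \<in> borel_measurable M"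
proof (rule measurableI)
  fix A :: "((real^'d) \<times> (real^'d)) set" assume "A \<in> sets borel"
  from Z_preimage[OF this] noise_indep[of k] show "Z k -` A \<inter> space M \<in> events"
    unfolding indep_set_def indep_sets_def UNIV_bool by auto
qed simp

lemma noise_indep_prob:
  assumes "A \<in> sets borel" "B \<in> sets borel"
  shows "prob (Z k -` A \<inter> space M \<inter> (w (Suc k) -` B \<inter> space M))
    = prob (Z k -` A \<inter> space M) * prob (w (Suc k) -` B \<inter> space M)"
proof (rule indep_setD[OF noise_indep Z_preimage[OF assms(1)]])
  show "w (Suc k) -` B \<inter> space M \<in> generated_events M w {Suc k}"
    unfolding generated_events_def using assms(2) by (intro sigma_sets.Basic) auto
qed

text \<open>The functionals \<open>h\<^sub>n\<^sub>+\<^sub>1 s + d h\<^sub>n s'\<close> of a state \<open>(s, s')\<close> are closed under one step of the recursion: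
  up to the contribution \<open>- \<alpha> h\<^sub>n\<^sub>+\<^sub>1\<close> of the fresh noise, the functional with index \<open>n\<close> becomes the one
  with index \<open>n + 1\<close>. Hence the induction on \<open>k\<close> peels off the last noise vector, which is
  independent of the state, with \<open>n\<close> and the weights \<open>a\<close> generalized. This needs only one noise
  vector at a time and avoids the joint law of all of them. The case \<open>n = 0\<close> concerns the
  current iterate itself.\<close>
lemma expectation_exp_square:
  fixes a :: "'d \<Rightarrow> real"
  assumes "\<And>j. a j > 0"
  shows "(\<integral>\<^sup>+\<omega>. ennreal (exp (\<Sum>j\<in>UNIV. a j * (impulse (c j) (d j) (Suc n) * coord (fst (Z k \<omega>)) j
             + d j * impulse (c j) (d j) n * coord (snd (Z k \<omega>)) j)\<^sup>2)) \<partial>M)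
    = (\<Prod>j\<in>UNIV. gaussian_exp_square (a j)
        (impulse (c j) (d j) (Suc (n + k)) * coord x0 j + d j * impulse (c j) (d j) (n + k) * coord xm1 j)
        (\<alpha>\<^sup>2 * \<sigma>\<^sup>2 * (\<Sum>i\<in>{n<..n+k}. (impulse (c j) (d j) i)\<^sup>2)))"
  using assms
proof (induction k arbitrary: n a)
  case 0
  show ?case
    by (simp add: Z_0 gaussian_exp_square_def exp_sum prod_ennreal emeasure_space_1)
next
  case (Suc k)
  define h where "h j = impulse (c j) (d j)" for j
  define lin where "lin z j = h j (Suc (Suc n)) * coord (fst z) j + d j * h j (Suc n) * coord (snd z) j"
    for z :: "(real^'d) \<times> (real^'d)" and j
  define l where "l j = - \<alpha> * h j (Suc n)" for j
  have step: "h j (Suc n) * coord (fst (Z (Suc k) \<omega>)) j + d j * h j n * coord (snd (Z (Suc k) \<omega>)) j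
      = lin (Z k \<omega>) j + l j * (U *v w (Suc k) \<omega>) $ j" for j \<omega>
    unfolding coord_step lin_def l_def h_def by (simp add: algebra_simps)
  define F where "F zw = ennreal (exp (\<Sum>j\<in>UNIV. a j * (lin (fst zw) j + l j * (U *v snd zw) $ j)\<^sup>2))"
    for zw :: "((real^'d) \<times> (real^'d)) \<times> (real^'d)"
  have cm: "continuous_on UNIV (\<lambda>y::real^'d. U *v y)"
    by (intro linear_continuous_on matrix_vector_mul_bounded_linear)
  have cn: "continuous_on UNIV (\<lambda>y. U *v g y)" if "continuous_on UNIV g" for g :: "'z::topological_space \<Rightarrow> real^'d"
    using continuous_on_compose2[OF cm that] by simp
  have F: "F \<in> borel_measurable borel" unfolding F_def lin_def
    by (intro measurable_compose[OF _ measurable_ennreal] borel_measurable_continuous_onI continuous_intros cn)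
  have inner: "(\<integral>\<^sup>+x. ennreal (isotropic_gaussian_density \<sigma> x) * F (z, x) \<partial>lborel)
      = (\<Prod>j\<in>UNIV. gaussian_exp_square (a j) (lin z j) ((l j)\<^sup>2 * \<sigma>\<^sup>2))" for z
  proof -
    have "(\<integral>\<^sup>+x. ennreal (isotropic_gaussian_density \<sigma> x) * F (z, x) \<partial>lborel)
      = (\<integral>\<^sup>+x. ennreal ((\<Prod>j\<in>UNIV. exp (a j * (lin z j + l j * (U *v x) $ j)\<^sup>2)) * isotropic_gaussian_density \<sigma> x) \<partial>lborel)"
      unfolding F_def by (simp add: exp_sum ennreal_mult[symmetric] prod_nonneg isotropic_gaussian_density_def mult.commute)
    also have "\<dots> = (\<Prod>j\<in>UNIV. \<integral>\<^sup>+t. ennreal (exp (a j * (lin z j + l j * t)\<^sup>2) * normal_density 0 \<sigma> t) \<partial>lborel)"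
      by (rule nn_integral_rotated_gaussian_prod[OF U \<sigma>, of "\<lambda>j t. exp (a j * (lin z j + l j * t)\<^sup>2)"]) auto
    also have "\<dots> = (\<Prod>j\<in>UNIV. gaussian_exp_square (a j) (lin z j) ((l j)\<^sup>2 * \<sigma>\<^sup>2))"
      using nn_integral_normal_exp_square[OF Suc.prems \<sigma>] by simp
    finally show ?thesis .
  qed
  have variance: "\<alpha>\<^sup>2 * \<sigma>\<^sup>2 * (\<Sum>i\<in>{Suc n<..Suc n+k}. (h j i)\<^sup>2) + (l j)\<^sup>2 * \<sigma>\<^sup>2
      = \<alpha>\<^sup>2 * \<sigma>\<^sup>2 * (\<Sum>i\<in>{n<..n+Suc k}. (h j i)\<^sup>2)" for j
  proof -
    have "{n<..n+Suc k} = insert (Suc n) {Suc n<..Suc n+k}" by auto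
    thus ?thesis unfolding l_def by (simp add: power_mult_distrib algebra_simps)
  qed
  have "(\<integral>\<^sup>+\<omega>. ennreal (exp (\<Sum>j\<in>UNIV. a j * (h j (Suc n) * coord (fst (Z (Suc k) \<omega>)) j
             + d j * h j n * coord (snd (Z (Suc k) \<omega>)) j)\<^sup>2)) \<partial>M)
    = (\<integral>\<^sup>+\<omega>. F (Z k \<omega>, w (Suc k) \<omega>) \<partial>M)"
    unfolding step F_def by simp
  also have "\<dots> = (\<integral>\<^sup>+\<omega>. (\<Prod>j\<in>UNIV. gaussian_exp_square (a j) (lin (Z k \<omega>) j) ((l j)\<^sup>2 * \<sigma>\<^sup>2)) \<partial>M)"
    unfolding inner[symmetric]
    by (rule nn_integral_indep_pair[OF Z_measurable noise_indep_prob noise_distributed F])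
  also have "\<dots> = (\<Prod>j\<in>UNIV. gaussian_exp_square (a j)
        (h j (Suc (Suc n + k)) * coord x0 j + d j * h j (Suc n + k) * coord xm1 j)
        (\<alpha>\<^sup>2 * \<sigma>\<^sup>2 * (\<Sum>i\<in>{Suc n<..Suc n+k}. (h j i)\<^sup>2) + (l j)\<^sup>2 * \<sigma>\<^sup>2))"
    (is "_ = (\<Prod>j\<in>UNIV. gaussian_exp_square (a j) (?m j) (?v j + _))")
  \<comment> \<open>If a single noise step already makes some mode divergent, both sides are infinite.\<close>
  proof (cases "\<forall>j. 2 * a j * ((l j)\<^sup>2 * \<sigma>\<^sup>2) < 1")
    case True
    define D where "D j = 1 - 2 * a j * ((l j)\<^sup>2 * \<sigma>\<^sup>2)" for j
    have D: "D j > 0" for j using True unfolding D_def by simp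
    have "(\<Prod>j\<in>UNIV. gaussian_exp_square (a j) (lin z j) ((l j)\<^sup>2 * \<sigma>\<^sup>2))
      = (\<Prod>j\<in>UNIV. ennreal (1 / sqrt (D j))) * ennreal (exp (\<Sum>j\<in>UNIV. a j / D j * (lin z j)\<^sup>2))" for z
    proof -
      have "gaussian_exp_square (a j) (lin z j) ((l j)\<^sup>2 * \<sigma>\<^sup>2)
        = ennreal (1 / sqrt (D j)) * ennreal (exp (a j / D j * (lin z j)\<^sup>2))" for j
      proof -
        have "1 / sqrt (D j) * exp (a j / D j * (lin z j)\<^sup>2) = exp (a j * (lin z j)\<^sup>2 / D j) / sqrt (D j)"
          by simp
        moreover have "gaussian_exp_square (a j) (lin z j) ((l j)\<^sup>2 * \<sigma>\<^sup>2) = ennreal (exp (a j * (lin z j)\<^sup>2 / D j) / sqrt (D j))"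
          using True unfolding gaussian_exp_square_def D_def by simp
        ultimately show ?thesis using D[of j] by (metis ennreal_mult less_imp_le exp_ge_zero real_sqrt_gt_0_iff zero_le_divide_1_iff)
      qed
      thus ?thesis by (simp add: prod.distrib exp_sum prod_ennreal)
    qed
    hence "(\<integral>\<^sup>+\<omega>. (\<Prod>j\<in>UNIV. gaussian_exp_square (a j) (lin (Z k \<omega>) j) ((l j)\<^sup>2 * \<sigma>\<^sup>2)) \<partial>M)
      = (\<integral>\<^sup>+\<omega>. (\<Prod>j\<in>UNIV. ennreal (1 / sqrt (D j))) * ennreal (exp (\<Sum>j\<in>UNIV. a j / D j * (lin (Z k \<omega>) j)\<^sup>2)) \<partial>M)"
      by simp
    also have "\<dots> = (\<Prod>j\<in>UNIV. ennreal (1 / sqrt (D j))) *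
        (\<integral>\<^sup>+\<omega>. ennreal (exp (\<Sum>j\<in>UNIV. a j / D j * (lin (Z k \<omega>) j)\<^sup>2)) \<partial>M)"
    proof (rule nn_integral_cmult)
      have "(\<lambda>z. ennreal (exp (\<Sum>j\<in>UNIV. a j / D j * (lin z j)\<^sup>2))) \<in> borel_measurable borel"
        unfolding lin_def
        by (intro measurable_compose[OF _ measurable_ennreal] borel_measurable_continuous_onI continuous_intros cn)
      from measurable_compose[OF Z_measurable this]
      show "(\<lambda>\<omega>. ennreal (exp (\<Sum>j\<in>UNIV. a j / D j * (lin (Z k \<omega>) j)\<^sup>2))) \<in> borel_measurable M" .
    qed
    also have "(\<integral>\<^sup>+\<omega>. ennreal (exp (\<Sum>j\<in>UNIV. a j / D j * (lin (Z k \<omega>) j)\<^sup>2)) \<partial>M)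
      = (\<Prod>j\<in>UNIV. gaussian_exp_square (a j / D j) (?m j) (?v j))"
      unfolding lin_def h_def by (rule Suc.IH) (use Suc.prems D in auto)
    also have "(\<Prod>j\<in>UNIV. ennreal (1 / sqrt (D j))) * (\<Prod>j\<in>UNIV. gaussian_exp_square (a j / D j) (?m j) (?v j))
      = (\<Prod>j\<in>UNIV. gaussian_exp_square (a j) (?m j) (?v j + (l j)\<^sup>2 * \<sigma>\<^sup>2))"
      unfolding prod.distrib[symmetric] D_def
      by (intro prod.cong refl gaussian_exp_square_add) (use Suc.prems True in \<open>auto intro!: mult_nonneg_nonneg sum_nonneg\<close>)
    finally show ?thesis .
  next
    case False
    then obtain j where j: "\<not> 2 * a j * ((l j)\<^sup>2 * \<sigma>\<^sup>2) < 1" by blast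
    have nz: "gaussian_exp_square (a i) m v \<noteq> 0" if "v \<ge> 0" for i m v
      using gaussian_exp_square_ge_1[OF Suc.prems that, of i m] by auto
    have "(\<Prod>j\<in>UNIV. gaussian_exp_square (a j) (lin z j) ((l j)\<^sup>2 * \<sigma>\<^sup>2)) = \<infinity>" for z
      by (rule prod_ennreal_eq_top[of _ j]) (use j nz in \<open>auto simp: gaussian_exp_square_def\<close>)
    moreover have "(\<Prod>j\<in>UNIV. gaussian_exp_square (a j) (?m j) (?v j + (l j)\<^sup>2 * \<sigma>\<^sup>2)) = \<infinity>"
    proof (rule prod_ennreal_eq_top[of _ j])
      have v: "0 \<le> ?v i" for i by (auto intro!: mult_nonneg_nonneg sum_nonneg)
      show "gaussian_exp_square (a i) (?m i) (?v i + (l i)\<^sup>2 * \<sigma>\<^sup>2) \<noteq> 0" for i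
        by (intro nz add_nonneg_nonneg v) auto
      have "0 \<le> 2 * a j * ?v j"
using Suc.prems[of j] by (intro mult_nonneg_nonneg[OF _ v]) simp
      hence "\<not> 2 * a j * (?v j + (l j)\<^sup>2 * \<sigma>\<^sup>2) < 1" using j unfolding distrib_left by linarith
      thus "gaussian_exp_square (a j) (?m j) (?v j + (l j)\<^sup>2 * \<sigma>\<^sup>2) = \<infinity>"
        unfolding gaussian_exp_square_def by simp
    qed
    ultimately show ?thesis by (simp add: emeasure_space_1)
  qed
  finally show ?case unfolding variance unfolding h_def by simp
qed

lemma exponential_moment:
  assumes e: "\<And>j. e j > 0" and \<theta>: "\<theta> > 0"
  shows "(\<integral>\<^sup>+\<omega>. ennreal (exp (\<theta> / (2 * \<sigma>\<^sup>2) * (quadratic Q p r (X k \<omega>) - quadratic Q p r xstar))) \<partial>M)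
    = (\<Prod>j\<in>UNIV. gaussian_exp_square (\<theta> * e j / (4 * \<sigma>\<^sup>2))
        (impulse (c j) (d j) (Suc k) * coord x0 j + d j * impulse (c j) (d j) k * coord xm1 j)
        (\<alpha>\<^sup>2 * \<sigma>\<^sup>2 * (\<Sum>i\<le>k. (impulse (c j) (d j) i)\<^sup>2)))"
proof -
  have "(\<Sum>i\<in>{0<..k}. (impulse (c j) (d j) i)\<^sup>2) = (\<Sum>i\<le>k. (impulse (c j) (d j) i)\<^sup>2)" for j
  proof -
    have "{..k} = insert 0 {0<..k}" by auto
    thus ?thesis by simp
  qed
  moreover have "\<theta> / (2 * \<sigma>\<^sup>2) * (quadratic Q p r (X k \<omega>) - quadratic Q p r xstar)
    = (\<Sum>j\<in>UNIV. \<theta> * e j / (4 * \<sigma>\<^sup>2) * (coord (X k \<omega>) j)\<^sup>2)" for \<omega>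
    unfolding quadratic_gap_coordinates[OF sym U diag stationary] by (simp add: sum_distrib_left mult_ac)
  ultimately show ?thesis
    using expectation_exp_square[of "\<lambda>j. \<theta> * e j / (4 * \<sigma>\<^sup>2)" 0 k] e \<theta> \<sigma>
    by (simp add: fst_Z)
qed

end

section \<open>Feasibility, spectral radius and convergence of the risk\<close>

text \<open>By the energy identity \<open>gmm_u\<close> is \<open>1 / (l \<alpha>\<^sup>2 S)\<close>. Conversely, \<open>\<theta> > 0\<close> makes \<open>gmm_u\<close>
  positive, which together with \<open>c\<^sup>2 < (1 - d)\<^sup>2\<close> forces \<open>\<bar>d\<bar> < 1\<close>, so that \<open>\<bar>1 - d\<bar> = 1 - d\<close>
  and the mode is stable.\<close>
lemma gmm_mode_feasible_iff:
  fixes \<alpha> \<beta> \<gamma> \<theta> l :: real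
  assumes pos: "l > 0" "\<alpha> > 0" "\<theta> > 0"
  defines "c \<equiv> gmm_c \<alpha> \<beta> \<gamma> l" and "d \<equiv> gmm_d \<alpha> \<beta> \<gamma> l"
  shows "\<bar>c\<bar> < \<bar>1 - d\<bar> \<and> \<theta> < 2 * gmm_u \<alpha> \<beta> \<gamma> l \<longleftrightarrow>
    summable (\<lambda>n. (impulse c d n)\<^sup>2) \<and> \<theta> * l * \<alpha>\<^sup>2 / 2 * (\<Sum>n. (impulse c d n)\<^sup>2) < 1"
proof -
  define S where "S = (\<Sum>n. (impulse c d n)\<^sup>2)"
  have u: "gmm_u \<alpha> \<beta> \<gamma> l = ((1 + d) * ((1 - d)\<^sup>2 - c\<^sup>2)) / (1 - d) / (l * \<alpha>\<^sup>2)"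
    unfolding gmm_u_def Let_def c_def d_def by (simp add: mult_ac)
  have key: "\<theta> < 2 * gmm_u \<alpha> \<beta> \<gamma> l \<longleftrightarrow> \<theta> * l * \<alpha>\<^sup>2 / 2 * S < 1"
    if sm: "summable (\<lambda>n. (impulse c d n)\<^sup>2)"
  proof -
    note en = impulse_energy[OF sm, folded S_def]
    have "((1 + d) * ((1 - d)\<^sup>2 - c\<^sup>2)) / (1 - d) = 1 / S"
      using en by (simp add: field_simps)
    hence "gmm_u \<alpha> \<beta> \<gamma> l = 1 / (S * (l * \<alpha>\<^sup>2))" unfolding u by simp
    moreover have "S * (l * \<alpha>\<^sup>2) > 0" using en(4) pos by simp
    ultimately show ?thesis by (simp add: field_simps)
  qed
  show ?thesis
  proof
    assume L: "\<bar>c\<bar> < \<bar>1 - d\<bar> \<and> \<theta> < 2 * gmm_u \<alpha> \<beta> \<gamma> l"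
    hence "c\<^sup>2 < (1 - d)\<^sup>2" by (meson abs_le_square_iff not_le)
    moreover have "0 < gmm_u \<alpha> \<beta> \<gamma> l" using L pos by linarith
    moreover have "gmm_u \<alpha> \<beta> \<gamma> l = (1 + d) / (1 - d) * (((1 - d)\<^sup>2 - c\<^sup>2) / (l * \<alpha>\<^sup>2))"
      unfolding u by simp
    ultimately have "0 < (1 + d) / (1 - d)"
      using pos zero_less_mult_pos2[of "(1 + d) / (1 - d)" "((1 - d)\<^sup>2 - c\<^sup>2) / (l * \<alpha>\<^sup>2)"] by simp
    hence "\<bar>d\<bar> < 1" by (auto simp: zero_less_divide_iff)
    moreover have "\<bar>c\<bar> < 1 - d" using L \<open>\<bar>d\<bar> < 1\<close> by simp
    ultimately have "summable (\<lambda>n. (impulse c d n)\<^sup>2)" by (rule impulse_summable)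
    with key L show "summable (\<lambda>n. (impulse c d n)\<^sup>2) \<and> \<theta> * l * \<alpha>\<^sup>2 / 2 * (\<Sum>n. (impulse c d n)\<^sup>2) < 1"
      unfolding S_def by blast
  next
    assume R: "summable (\<lambda>n. (impulse c d n)\<^sup>2) \<and> \<theta> * l * \<alpha>\<^sup>2 / 2 * (\<Sum>n. (impulse c d n)\<^sup>2) < 1"
    with key have "\<theta> < 2 * gmm_u \<alpha> \<beta> \<gamma> l" unfolding S_def by blast
    moreover have "\<bar>c\<bar> < \<bar>1 - d\<bar>" using impulse_energy(2) R by fastforce
    ultimately show "\<bar>c\<bar> < \<bar>1 - d\<bar> \<and> \<theta> < 2 * gmm_u \<alpha> \<beta> \<gamma> l" by blast
  qed
qed

lemma finite_characteristic_roots: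
  "finite {z::complex. z\<^sup>2 = of_real c * z + of_real d}"
proof -
  obtain r1 r2 where r: "r1 + r2 = complex_of_real c" "r1 * r2 = - complex_of_real d"
    by (metis characteristic_roots)
  have "z \<in> {r1, r2}" if "z\<^sup>2 = of_real c * z + of_real d" for z
  proof -
    have "(z - r1) * (z - r2) = z\<^sup>2 - (r1 + r2) * z + r1 * r2" by (simp add: power2_eq_square algebra_simps)
    also have "\<dots> = 0" using r that by simp
    finally show ?thesis by auto
  qed
  hence "{z. z\<^sup>2 = of_real c * z + of_real d} \<subseteq> {r1, r2}" by blast
  thus ?thesis by (rule finite_subset) simp
qed

lemma spectral_radius_gmm_matrix:
  fixes Q U :: "real^'d^'d"
  assumes U: "orthogonal_matrix U" and diag: "\<And>x j. (U *v (Q *v x)) $ j = e j * (U *v x) $ j"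
  shows "spectral_radius (gmm_matrix Q \<alpha> \<beta> \<gamma>)
    = Max (range (\<lambda>j. rate_rho (gmm_c \<alpha> \<beta> \<gamma> (e j)) (gmm_d \<alpha> \<beta> \<gamma> (e j))))"
  unfolding spectral_radius_def complex_spectrum_gmm_matrix[OF U diag]
proof (rule Max_eqI)
  let ?\<rho> = "\<lambda>j. rate_rho (gmm_c \<alpha> \<beta> \<gamma> (e j)) (gmm_d \<alpha> \<beta> \<gamma> (e j))"
  let ?R = "\<lambda>j. {z::complex. z\<^sup>2 = gmm_c \<alpha> \<beta> \<gamma> (e j) * z + gmm_d \<alpha> \<beta> \<gamma> (e j)}"
  show "finite (cmod ` (\<Union>j. ?R j))" by (intro finite_imageI finite_UN_I finite_characteristic_roots) simp
  show "y \<le> Max (range ?\<rho>)" if y: "y \<in> cmod ` (\<Union>j. ?R j)" for y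
  proof -
    from y obtain j z where z: "z \<in> ?R j" "y = cmod z" by blast
    have "y \<le> ?\<rho> j" using z by (simp add: root_le_rate_rho)
    also have "\<dots> \<le> Max (range ?\<rho>)" by (rule Max_ge) auto
    finally show ?thesis .
  qed
  have "Max (range ?\<rho>) \<in> range ?\<rho>" by (rule Max_in) auto
  then obtain j where j: "Max (range ?\<rho>) = ?\<rho> j" by blast
  obtain z :: complex where z: "z\<^sup>2 = gmm_c \<alpha> \<beta> \<gamma> (e j) * z + gmm_d \<alpha> \<beta> \<gamma> (e j)" "cmod z = ?\<rho> j"
    by (rule rate_rho_root)
  show "Max (range ?\<rho>) \<in> cmod ` (\<Union>j. ?R j)" unfolding j z(2)[symmetric]
    by (intro imageI UN_I[of j]) (simp_all add: z(1))
qed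

text \<open>A stationary point exists because \<open>Q\<close> is invertible, and it attains the minimum because \<open>Q\<close> is
  positive definite; a strict minimizer must then be this point.\<close>
lemma quadratic_minimizer_stationary:
  fixes Q U :: "real^'d^'d"
  assumes sym: "transpose Q = Q" and U: "orthogonal_matrix U"
    and diag: "\<And>x j. (U *v (Q *v x)) $ j = e j * (U *v x) $ j" and e: "\<And>j. e j > 0"
    and min: "\<And>y. y \<noteq> xstar \<Longrightarrow> quadratic Q p r xstar < quadratic Q p r y"
  shows "Q *v xstar + p = 0"
proof -
  define y where "y = transpose U *v (\<chi> j. - (U *v p) $ j / e j)"
  have "U *v y = (\<chi> j. - (U *v p) $ j / e j)"
    using U unfolding y_def orthogonal_matrix_def
    by (simp add: matrix_vector_mul_assoc del: transpose_matrix_vector)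
  hence "(U *v (Q *v y + p)) $ j = 0" for j
    using e[of j] by (simp add: matrix_vector_right_distrib diag)
  hence "U *v (Q *v y + p) = U *v 0" by (simp add: vec_eq_iff)
  hence y: "Q *v y + p = 0" unfolding orthogonal_matrix_inject[OF U] .
  have "0 \<le> quadratic Q p r xstar - quadratic Q p r y"
    unfolding quadratic_gap_coordinates[OF sym U diag y] using e
    by (auto intro!: sum_nonneg mult_nonneg_nonneg simp: less_imp_le)
  hence "y = xstar" using min[of y] by force
  thus ?thesis using y by simp
qed

lemma ln_ennreal_ennreal: "x > 0 \<Longrightarrow> ln_ennreal (ennreal x) = ereal (ln x)"
  unfolding ln_ennreal_def by (simp add: ennreal_eq_0_iff)

lemma ln_ennreal_prod_gaussian_exp_square:
  fixes a m v :: "'d::finite \<Rightarrow> real"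
  assumes "\<And>j. 2 * a j * v j < 1"
  shows "ln_ennreal (\<Prod>j\<in>UNIV. gaussian_exp_square (a j) (m j) (v j))
    = ereal (\<Sum>j\<in>UNIV. a j * (m j)\<^sup>2 / (1 - 2 * a j * v j) - ln (1 - 2 * a j * v j) / 2)"
proof -
  define g where "g j = exp (a j * (m j)\<^sup>2 / (1 - 2 * a j * v j)) / sqrt (1 - 2 * a j * v j)" for j
  have g: "g j > 0" for j unfolding g_def using assms[of j] by simp
  have ln_g: "ln (g j) = a j * (m j)\<^sup>2 / (1 - 2 * a j * v j) - ln (1 - 2 * a j * v j) / 2" for j
    unfolding g_def using assms[of j] by (simp add: ln_div ln_sqrt)
  have "(\<Prod>j\<in>UNIV. gaussian_exp_square (a j) (m j) (v j)) = (\<Prod>j\<in>UNIV. ennreal (g j))"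
    unfolding gaussian_exp_square_def g_def using assms by simp
  also have "\<dots> = ennreal (\<Prod>j\<in>UNIV. g j)" using g by (simp add: prod_ennreal less_imp_le)
  finally have "ln_ennreal (\<Prod>j\<in>UNIV. gaussian_exp_square (a j) (m j) (v j)) = ereal (ln (\<Prod>j\<in>UNIV. g j))"
    using g by (simp add: ln_ennreal_ennreal prod_pos)
  also have "ln (\<Prod>j\<in>UNIV. g j) = (\<Sum>j\<in>UNIV. ln (g j))"
  proof (rule ln_prod)
    show "g j \<noteq> 0" for j using g[of j] by simp
  qed simp
  finally show ?thesis unfolding ln_g .
qed

text \<open>A bound on the moment keeps \<open>2 a v\<close> at a fixed distance from the threshold one.\<close>
lemma gaussian_exp_square_le_imp:
  assumes "a > 0" "v \<ge> 0" "gaussian_exp_square a m v \<le> ennreal B"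
  shows "2 * a * v \<le> 1 - 1 / B\<^sup>2" "1 \<le> B"
proof -
  have "1 \<le> ennreal B" using gaussian_exp_square_ge_1[OF assms(1,2)] assms(3) by (rule order_trans)
  thus B: "1 \<le> B" by simp
  have lt: "2 * a * v < 1" using assms(3) unfolding gaussian_exp_square_def
    by (auto split: if_splits simp: top_unique)
  define s where "s = sqrt (1 - 2 * a * v)"
  have s: "s > 0" using lt unfolding s_def by simp
  have "1 / s \<le> exp (a * m\<^sup>2 / (1 - 2 * a * v)) / s"
    using s lt assms by (intro divide_right_mono) auto
  also have "\<dots> \<le> B" using assms(3) lt B unfolding gaussian_exp_square_def s_def by simp
  finally have "1 / B \<le> s" using s B by (simp add: field_simps)
  hence "(1 / B)\<^sup>2 \<le> s\<^sup>2" using B by (intro power_mono) auto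
  thus "2 * a * v \<le> 1 - 1 / B\<^sup>2" using lt unfolding s_def by (simp add: power_divide)
qed

text \<open>The right-hand side separates the two sources of error, the squared mean and the missing
  variance; the second uses that the logarithm is Lipschitz above \<open>1 - 2 a v'\<close>.\<close>
lemma log_moment_gap:
  fixes a m v v' :: real
  assumes "a > 0" "v \<le> v'" "2 * a * v' < 1"
  shows "\<bar>(a * m\<^sup>2 / (1 - 2 * a * v) - ln (1 - 2 * a * v) / 2) - (- ln (1 - 2 * a * v') / 2)\<bar>
    \<le> a / (1 - 2 * a * v') * (m\<^sup>2 + (v' - v))"
proof -
  define D D' where "D = 1 - 2 * a * v" and "D' = 1 - 2 * a * v'"
  have D: "0 < D'" "D' \<le> D" unfolding D_def D'_def using assms by auto
  have "ln (D / D') \<le> D / D' - 1" using D by (intro ln_le_minus_one) auto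
  also have "\<dots> = 2 * a * (v' - v) / D'" using D unfolding D_def D'_def by (simp add: field_simps)
  finally have 1: "ln D - ln D' \<le> 2 * a * (v' - v) / D'" using D by (simp add: ln_div)
  have 2: "0 \<le> ln D - ln D'" using D by simp
  have 3: "a * m\<^sup>2 / D \<le> a * m\<^sup>2 / D'" using D assms(1) by (intro divide_left_mono) auto
  have 4: "0 \<le> a * m\<^sup>2 / D" using D assms(1) by simp
  have "a / D' * (m\<^sup>2 + (v' - v)) = a * m\<^sup>2 / D' + 2 * a * (v' - v) / D' / 2"
    using D by (simp add: add_divide_distrib diff_divide_distrib algebra_simps)
  moreover have "\<bar>A - x / 2 - (- y / 2)\<bar> \<le> W"
    if "x - y \<le> t" "0 \<le> x - y" "A \<le> A'" "0 \<le> A" "W = A' + t / 2" for A A' x y t W :: real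
    using that by linarith
  ultimately show ?thesis unfolding D_def[symmetric] D'_def[symmetric] using 1 2 3 4 by blast
qed


lemma impulse_mode_rate:
  assumes "\<bar>d\<bar> < 1" "\<bar>c\<bar> < 1 - d"
  shows "\<exists>K\<ge>0. \<forall>k\<ge>1. (impulse c d (Suc k) * s + d * impulse c d k * s')\<^sup>2
      + ((\<Sum>n. (impulse c d n)\<^sup>2) - (\<Sum>i\<le>k. (impulse c d i)\<^sup>2))
      \<le> K * ((rate_C c d k)\<^sup>2 * rate_rho c d ^ (2 * (k - 1)))"
proof -
  define S where "S = (\<Sum>n. (impulse c d n)\<^sup>2)"
  have S: "S \<ge> 0" unfolding S_def by (intro suminf_nonneg impulse_summable assms) auto
  obtain K where K: "K \<ge> 0" "\<And>k. 1 \<le> k \<Longrightarrow> (impulse c d k)\<^sup>2 + (impulse c d (Suc k))\<^sup>2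
      \<le> K * ((rate_C c d k)\<^sup>2 * rate_rho c d ^ (2 * (k - 1)))"
    using impulse_square_decay[OF assms] by blast
  define K' where "K' = 2 * (s\<^sup>2 + s'\<^sup>2) + 2 * S"
  have K': "K' \<ge> 0" unfolding K'_def using S by simp
  have d: "d\<^sup>2 \<le> 1" using assms(1) by (simp add: abs_square_le_1)
  have sq: "(A * s + d * B * s')\<^sup>2 \<le> 2 * (s\<^sup>2 + s'\<^sup>2) * (B\<^sup>2 + A\<^sup>2)" for A B :: real
  proof -
    have "(A * s + d * B * s')\<^sup>2 + (A * s - d * B * s')\<^sup>2 = 2 * (A\<^sup>2 * s\<^sup>2) + 2 * (d\<^sup>2 * (B\<^sup>2 * s'\<^sup>2))"
      by (simp add: power2_eq_square algebra_simps)
    moreover have "d\<^sup>2 * (B\<^sup>2 * s'\<^sup>2) \<le> 1 * (B\<^sup>2 * s'\<^sup>2)" using d by (intro mult_right_mono) auto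
    moreover have "0 \<le> A\<^sup>2 * s'\<^sup>2" "0 \<le> B\<^sup>2 * s\<^sup>2" "0 \<le> (A * s - d * B * s')\<^sup>2" by simp_all
    moreover have "2 * (s\<^sup>2 + s'\<^sup>2) * (B\<^sup>2 + A\<^sup>2) = 2 * (A\<^sup>2 * s\<^sup>2) + 2 * (B\<^sup>2 * s'\<^sup>2) + 2 * (A\<^sup>2 * s'\<^sup>2) + 2 * (B\<^sup>2 * s\<^sup>2)"
      by (simp add: algebra_simps)
    moreover have "P \<le> W" if "P + N = 2 * x + 2 * z" "z \<le> 1 * y" "0 \<le> u" "0 \<le> v" "0 \<le> N"
        "W = 2 * x + 2 * y + 2 * u + 2 * v" for P N x y z u v W :: real
      using that by linarith
    ultimately show ?thesis by blast
  qed
  have "(impulse c d (Suc k) * s + d * impulse c d k * s')\<^sup>2 + (S - (\<Sum>i\<le>k. (impulse c d i)\<^sup>2))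
      \<le> K' * K * ((rate_C c d k)\<^sup>2 * rate_rho c d ^ (2 * (k - 1)))" if k: "1 \<le> k" for k
  proof -
    have "(impulse c d (Suc k) * s + d * impulse c d k * s')\<^sup>2 + (S - (\<Sum>i\<le>k. (impulse c d i)\<^sup>2))
      \<le> K' * ((impulse c d k)\<^sup>2 + (impulse c d (Suc k))\<^sup>2)"
      unfolding K'_def distrib_right[of "2 * (s\<^sup>2 + s'\<^sup>2)"]
      using impulse_tail[OF assms, of k, folded S_def] by (intro add_mono sq)
    also have "\<dots> \<le> K' * (K * ((rate_C c d k)\<^sup>2 * rate_rho c d ^ (2 * (k - 1))))"
      by (intro mult_left_mono K(2) k K')
    finally show ?thesis by (simp add: mult.assoc)
  qed
  thus ?thesis unfolding S_def[symmetric] using K K' by (intro exI[of _ "K' * K"]) simp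
qed

text \<open>A bound by \<open>g\<close> gives the rate, and a geometric bound on \<open>g\<close> gives convergence, hence
  identifies the limit superior.\<close>
lemma limsup_linear_convergence:
  fixes X :: "nat \<Rightarrow> ereal" and R g :: "nat \<Rightarrow> real"
  assumes X: "\<And>k. X k = ereal (R k)"
    and bound: "\<And>k. 1 \<le> k \<Longrightarrow> \<bar>R k - l\<bar> \<le> K * g k" and K: "K \<ge> 0"
    and g: "\<And>k. 1 \<le> k \<Longrightarrow> g k \<le> B * q ^ k" "\<And>k. 0 \<le> g k" and q: "0 < q" "q < 1"
    and G: "\<And>k. g k \<le> G k"
  shows "limsup X = ereal l" "converges_linearly X (limsup X)" "big_O (\<lambda>k. \<bar>X k - limsup X\<bar>) G"
proof -
  have geo: "\<bar>R k - l\<bar> \<le> (K * \<bar>B\<bar> + 1) * q ^ k" if "1 \<le> k" for k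
  proof -
    have "\<bar>R k - l\<bar> \<le> K * g k" by (rule bound[OF that])
    also have "\<dots> \<le> K * (\<bar>B\<bar> * q ^ k)"
    proof (intro mult_left_mono K)
      have "g k \<le> B * q ^ k" by (rule g(1)[OF that])
      also have "\<dots> \<le> \<bar>B\<bar> * q ^ k" using q by (intro mult_right_mono) auto
      finally show "g k \<le> \<bar>B\<bar> * q ^ k" .
    qed
    also have "\<dots> \<le> (K * \<bar>B\<bar> + 1) * q ^ k" using q by (simp add: algebra_simps)
    finally show ?thesis .
  qed
  have "(\<lambda>k. R k - l) \<longlonglongrightarrow> 0"
  proof (rule Lim_null_comparison)
    show "\<forall>\<^sub>F k in sequentially. norm (R k - l) \<le> (K * \<bar>B\<bar> + 1) * q ^ k"
      using geo by (auto simp: eventually_sequentially intro!: exI[of _ 1])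
    show "(\<lambda>k. (K * \<bar>B\<bar> + 1) * q ^ k) \<longlonglongrightarrow> 0"
      using q by (intro tendsto_mult_right_zero LIMSEQ_power_zero) auto
  qed
  hence lim: "X \<longlonglongrightarrow> ereal l" unfolding X by (simp add: LIM_zero_iff)
  thus L: "limsup X = ereal l" by (intro lim_imp_Limsup) auto
  have diff: "\<bar>X k - limsup X\<bar> = ereal \<bar>R k - l\<bar>" for k unfolding L X by simp
  show "converges_linearly X (limsup X)"
    unfolding converges_linearly_def big_O_def diff
  proof (intro conjI exI)
    show "X \<longlonglongrightarrow> limsup X" using lim unfolding L .
    show "0 < q" "q < 1" by (rule q)+
    show "0 < K * \<bar>B\<bar> + 1" using K by (simp add: add_nonneg_pos)
    show "\<forall>k>0. ereal \<bar>R k - l\<bar> \<le> ereal ((K * \<bar>B\<bar> + 1) * q ^ k)" using geo by simp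
  qed
  show "big_O (\<lambda>k. \<bar>X k - limsup X\<bar>) G" unfolding big_O_def diff
  proof (intro exI conjI allI impI)
    show "0 < K + 1" using K by simp
    fix k :: nat assume "k > 0"
    hence "\<bar>R k - l\<bar> \<le> K * g k" by (intro bound) simp
    also have "\<dots> \<le> (K + 1) * G k" using K g(2)[of k] G[of k] by (intro mult_mono) auto
    finally show "ereal \<bar>R k - l\<bar> \<le> ereal ((K + 1) * G k)" by simp
  qed
qed

lemma gmm_C_rate_geometric:
  assumes "0 \<le> \<rho>" "\<rho> < q" "n \<ge> 1"
  shows "\<exists>B. \<forall>k\<ge>1. \<bar>gmm_C lam n \<alpha> \<beta> \<gamma> k\<bar> * \<rho> ^ (k - 1) \<le> B * q ^ k"
proof -
  let ?C = "\<lambda>i k. rate_C (gmm_c \<alpha> \<beta> \<gamma> (lam i)) (gmm_d \<alpha> \<beta> \<gamma> (lam i)) k"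
  have "\<forall>i. \<exists>K\<ge>0. \<forall>k. ?C i k \<le> K * (1 + real k)" using rate_C_linear_growth by blast
  then obtain K where K: "\<And>i. K i \<ge> 0" "\<And>i k. ?C i k \<le> K i * (1 + real k)" by metis
  obtain B where B: "B \<ge> 0" "\<And>k. 1 \<le> k \<Longrightarrow> (1 + real k) * \<rho> ^ (k - 1) \<le> B * q ^ k"
    using linear_times_geometric_bounded[OF assms(1,2)] by blast
  define K' where "K' = (\<Sum>i\<in>{1..n}. K i)"
  have K': "K' \<ge> 0" unfolding K'_def by (intro sum_nonneg K)
  have C: "0 \<le> gmm_C lam n \<alpha> \<beta> \<gamma> k \<and> gmm_C lam n \<alpha> \<beta> \<gamma> k \<le> K' * (1 + real k)" for k
  proof -
    have "gmm_C lam n \<alpha> \<beta> \<gamma> k \<in> (\<lambda>i. ?C i k) ` {1..n}"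
      unfolding gmm_C_def using assms(3) by (intro Max_in) auto
    then obtain i where i: "i \<in> {1..n}" "gmm_C lam n \<alpha> \<beta> \<gamma> k = ?C i k" by blast
    have "?C i k \<le> K i * (1 + real k)" by (rule K)
    also have "\<dots> \<le> K' * (1 + real k)" unfolding K'_def
      using i K(1) by (intro mult_right_mono member_le_sum) auto
    finally show ?thesis using i rate_C_nonneg by simp
  qed
  have "\<bar>gmm_C lam n \<alpha> \<beta> \<gamma> k\<bar> * \<rho> ^ (k - 1) \<le> K' * B * q ^ k" if k: "1 \<le> k" for k
  proof -
    have "\<bar>gmm_C lam n \<alpha> \<beta> \<gamma> k\<bar> * \<rho> ^ (k - 1) \<le> K' * (1 + real k) * \<rho> ^ (k - 1)"
      using C[of k] assms(1) by (intro mult_right_mono) auto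
    also have "\<dots> \<le> K' * (B * q ^ k)"
      unfolding mult.assoc by (intro mult_left_mono B(2) k K')
    finally show ?thesis by (simp add: mult.assoc)
  qed
  thus ?thesis by blast
qed



lemma ln_ennreal_less_imp_le:
  assumes "ln_ennreal x < ereal B"
  shows "x \<le> ennreal (exp B)"
proof (cases "x = \<infinity> \<or> x = 0")
  case True
  thus ?thesis using assms by (auto simp: ln_ennreal_def)
next
  case False
  then obtain y where y: "x = ennreal y" "y > 0"
    by (cases x) (auto simp: order_le_less)
  have "ln y < B" using assms unfolding y(1) ln_ennreal_ennreal[OF y(2)] by simp
  hence "exp (ln y) \<le> exp B" unfolding exp_le_cancel_iff by simp
  hence "y \<le> exp B" using y(2) by simp
  thus ?thesis unfolding y(1) by (rule ennreal_leI)
qed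

theorem proposition1:
  fixes Q :: "real^'d^'d" and p :: "real^'d" and r \<mu> L :: real and lam :: "nat \<Rightarrow> real"
    and f :: "real^'d \<Rightarrow> real" and xstar x0 xm1 :: "real^'d"
    and \<alpha> \<beta> \<gamma> \<sigma> \<theta> :: real
    and M :: "'w measure" and w x :: "nat \<Rightarrow> 'w \<Rightarrow> real^'d"
    and rk :: "nat \<Rightarrow> ereal" and rinf :: ereal
  assumes "0 < \<mu>" and "\<mu> < L"
    and "transpose Q = Q"
    and "ordered_eigenvalues Q lam" and "lam 1 = \<mu>" and "lam CARD('d) = L"
    and f_def: "f = quadratic Q p r"
    and "\<forall>y. y \<noteq> xstar \<longrightarrow> f xstar < f y"
    and "\<alpha> > 0" and "\<beta> \<ge> 0" and "\<gamma> \<ge> 0"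
    and "\<sigma> > 0" and "\<theta> > 0"
    and "prob_space M"
    and x_def: "x = (\<lambda>k \<omega>. gmm f \<alpha> \<beta> \<gamma> x0 xm1 (\<lambda>j. w j \<omega>) k)"
    and "gaussian_noise M \<sigma> x w"
    and rk_def: "rk = (\<lambda>k. entropic_risk M \<sigma> \<theta> (\<lambda>\<omega>. f (x k \<omega>) - f xstar))"
    and rinf_def: "rinf = limsup rk"
  shows "(\<bar>rinf\<bar> \<noteq> \<infinity> \<longleftrightarrow> (\<alpha>, \<beta>, \<gamma>) \<in> feasible_set lam CARD('d) \<theta>) \<and>
         ((\<alpha>, \<beta>, \<gamma>) \<in> feasible_set lam CARD('d) \<theta> \<longrightarrow>
            spectral_radius (gmm_matrix Q \<alpha> \<beta> \<gamma>) < 1 \<and>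
            converges_linearly rk rinf \<and>
            big_O (\<lambda>k. \<bar>rk k - rinf\<bar>)
              (\<lambda>k. (gmm_C lam CARD('d) \<alpha> \<beta> \<gamma> k)\<^sup>2 * spectral_radius (gmm_matrix Q \<alpha> \<beta> \<gamma>) ^ (2 * (k - 1))
                 + (gmm_C lam CARD('d) \<alpha> \<beta> \<gamma> k) ^ 4 * spectral_radius (gmm_matrix Q \<alpha> \<beta> \<gamma>) ^ (4 * (k - 1))))"
proof -
  obtain U :: "real^'d^'d" and e where U: "orthogonal_matrix U"
    and diag: "\<And>x j. (U *v (Q *v x)) $ j = e j * (U *v x) $ j"
    using symmetric_matrix_diagonalization[OF assms(3)] by blast
  have lam: "lam ` {1..CARD('d)} = range e"
    by (rule diagonalization_eigenvalues[OF U diag assms(4)])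
  have n: "CARD('d) \<ge> 1" by (simp add: Suc_le_eq)
  have e: "e j > 0" for j
  proof -
    have "e j \<in> lam ` {1..CARD('d)}" unfolding lam by simp
    then obtain i where i: "i \<in> {1..CARD('d)}" "e j = lam i" by auto
    have "lam 1 \<le> lam i"
      using assms(4) i n unfolding ordered_eigenvalues_def mono_on_def by auto
    thus ?thesis using i assms(1,5) by simp
  qed
  interpret gmm_process M Q U e p xstar x0 xm1 r \<alpha> \<beta> \<gamma> \<sigma> w
  proof (intro gmm_process.intro gmm_process_axioms.intro)
    show "Q *v xstar + p = 0"
      by (rule quadratic_minimizer_stationary[OF assms(3) U diag e]) (use assms(8) f_def in auto)
    show "gaussian_noise M \<sigma> (\<lambda>k \<omega>. gmm (quadratic Q p r) \<alpha> \<beta> \<gamma> x0 xm1 (\<lambda>j. w j \<omega>) k) w"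
      using assms(16) unfolding x_def f_def .
  qed (use assms U diag in auto)

  define h where "h j = impulse (c j) (d j)" for j
  define a where "a j = \<theta> * e j / (4 * \<sigma>\<^sup>2)" for j
  define m where "m k j = h j (Suc k) * coord x0 j + d j * h j k * coord xm1 j" for k j
  define T where "T k j = (\<Sum>i\<le>k. (h j i)\<^sup>2)" for k j
  define v where "v k j = \<alpha>\<^sup>2 * \<sigma>\<^sup>2 * T k j" for k j
  \<comment> \<open>Chosen so that \<open>2 a v = \<kappa> T\<close> for the variance \<open>v\<close> belonging to a partial energy \<open>T\<close>.\<close>
  define \<kappa> where "\<kappa> j = \<theta> * e j * \<alpha>\<^sup>2 / 2" for j
  have a: "a j > 0" for j unfolding a_def using e assms by simp
  have \<kappa>: "\<kappa> j > 0" for j unfolding \<kappa>_def using e assms by simp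
  have av: "2 * a j * (\<alpha>\<^sup>2 * \<sigma>\<^sup>2 * t) = \<kappa> j * t" for j t
    unfolding a_def \<kappa>_def using assms by (simp add: field_simps)
  have T0: "T k j \<ge> 0" for k j unfolding T_def by (intro sum_nonneg) auto
  have v0: "v k j \<ge> 0" for k j unfolding v_def by (intro mult_nonneg_nonneg T0) auto
  have rk: "rk k = ereal (2 * \<sigma>\<^sup>2 / \<theta>) * ln_ennreal (\<Prod>j\<in>UNIV. gaussian_exp_square (a j) (m k j) (v k j))" for k
    unfolding rk_def entropic_risk_def x_def f_def X_def[symmetric]
    unfolding exponential_moment[OF e assms(13)] a_def m_def v_def T_def h_def ..

  have feas: "(\<alpha>, \<beta>, \<gamma>) \<in> feasible_set lam CARD('d) \<theta> \<longleftrightarrow>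
      (\<forall>j. summable (\<lambda>i. (h j i)\<^sup>2) \<and> \<kappa> j * (\<Sum>i. (h j i)\<^sup>2) < 1)"
  proof -
    have "(\<alpha>, \<beta>, \<gamma>) \<in> feasible_set lam CARD('d) \<theta> \<longleftrightarrow>
      (\<forall>l\<in>lam ` {1..CARD('d)}. \<bar>gmm_c \<alpha> \<beta> \<gamma> l\<bar> < \<bar>1 - gmm_d \<alpha> \<beta> \<gamma> l\<bar> \<and> \<theta> < 2 * gmm_u \<alpha> \<beta> \<gamma> l)"
      unfolding feasible_set_def using assms by simp
    also have "\<dots> \<longleftrightarrow> (\<forall>j. \<bar>c j\<bar> < \<bar>1 - d j\<bar> \<and> \<theta> < 2 * gmm_u \<alpha> \<beta> \<gamma> (e j))"
      unfolding lam by simp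
    also have "\<dots> \<longleftrightarrow> (\<forall>j. summable (\<lambda>i. (h j i)\<^sup>2) \<and> \<kappa> j * (\<Sum>i. (h j i)\<^sup>2) < 1)"
      unfolding gmm_mode_feasible_iff[OF e assms(9) assms(13)] h_def \<kappa>_def ..
    finally show ?thesis .
  qed

  have conv: "spectral_radius (gmm_matrix Q \<alpha> \<beta> \<gamma>) < 1 \<and> \<bar>rinf\<bar> \<noteq> \<infinity> \<and>
            converges_linearly rk rinf \<and>
            big_O (\<lambda>k. \<bar>rk k - rinf\<bar>)
              (\<lambda>k. (gmm_C lam CARD('d) \<alpha> \<beta> \<gamma> k)\<^sup>2 * spectral_radius (gmm_matrix Q \<alpha> \<beta> \<gamma>) ^ (2 * (k - 1))
                 + (gmm_C lam CARD('d) \<alpha> \<beta> \<gamma> k) ^ 4 * spectral_radius (gmm_matrix Q \<alpha> \<beta> \<gamma>) ^ (4 * (k - 1)))"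
    if F: "(\<alpha>, \<beta>, \<gamma>) \<in> feasible_set lam CARD('d) \<theta>"
  proof -
    define S where "S j = (\<Sum>i. (h j i)\<^sup>2)" for j
    define \<rho> where "\<rho> = spectral_radius (gmm_matrix Q \<alpha> \<beta> \<gamma>)"
    define C where "C k = gmm_C lam CARD('d) \<alpha> \<beta> \<gamma> k" for k
    have sm: "summable (\<lambda>i. (h j i)\<^sup>2)" and \<kappa>S: "\<kappa> j * S j < 1" for j
      using F feas unfolding S_def by auto
    have stable: "\<bar>d j\<bar> < 1" "\<bar>c j\<bar> < 1 - d j" for j
      by (rule impulse_energy(1,2)[OF sm[of j, unfolded h_def]])+
    have \<rho>_Max: "\<rho> = Max (range (\<lambda>j. rate_rho (c j) (d j)))"
      unfolding \<rho>_def by (rule spectral_radius_gmm_matrix[OF U diag])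
    have \<rho>_ge: "rate_rho (c j) (d j) \<le> \<rho>" for j unfolding \<rho>_Max by (rule Max_ge) auto
    have "\<rho> \<in> range (\<lambda>j. rate_rho (c j) (d j))" unfolding \<rho>_Max by (rule Max_in) auto
    hence \<rho>: "0 \<le> \<rho>" "\<rho> < 1" using rate_rho_nonneg rate_rho_less_1[OF stable] by auto
    have C_ge: "rate_C (c j) (d j) k \<le> C k" for j k
    proof -
      have "e j \<in> lam ` {1..CARD('d)}" unfolding lam by simp
      then obtain i where i: "i \<in> {1..CARD('d)}" "e j = lam i" by auto
      show ?thesis unfolding C_def gmm_C_def i(2) by (rule Max_ge) (use i(1) in auto)
    qed
    have C0: "0 \<le> C k" for k by (rule order_trans[OF rate_C_nonneg C_ge])
    have TS: "T k j \<le> S j" for k j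
      unfolding T_def S_def using sum_le_suminf[OF sm[of j], of "{..k}"] by simp
    have \<kappa>T: "\<kappa> j * T k j < 1" for k j
      using mult_left_mono[OF TS, of "\<kappa> j"] \<kappa>[of j] \<kappa>S[of j] by (meson le_less_trans less_imp_le)
    define R where "R k = 2 * \<sigma>\<^sup>2 / \<theta> * (\<Sum>j\<in>UNIV. a j * (m k j)\<^sup>2 / (1 - 2 * a j * v k j) - ln (1 - 2 * a j * v k j) / 2)" for k
    define l where "l = 2 * \<sigma>\<^sup>2 / \<theta> * (\<Sum>j\<in>UNIV. - ln (1 - \<kappa> j * S j) / 2)"
    have rkR: "rk k = ereal (R k)" for k
      unfolding rk R_def by (subst ln_ennreal_prod_gaussian_exp_square) (simp_all add: v_def av \<kappa>T)
    define g where "g k = (C k)\<^sup>2 * \<rho> ^ (2 * (k - 1))" for k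
    have "\<forall>j. \<exists>K\<ge>0. \<forall>k\<ge>1. (m k j)\<^sup>2 + (S j - T k j)
        \<le> K * ((rate_C (c j) (d j) k)\<^sup>2 * rate_rho (c j) (d j) ^ (2 * (k - 1)))"
      unfolding m_def S_def T_def h_def using impulse_mode_rate[OF stable] by blast
    then obtain K where K: "\<And>j. K j \<ge> 0" "\<And>j k. 1 \<le> k \<Longrightarrow> (m k j)\<^sup>2 + (S j - T k j)
        \<le> K j * ((rate_C (c j) (d j) k)\<^sup>2 * rate_rho (c j) (d j) ^ (2 * (k - 1)))"
      by metis
    have mode: "(m k j)\<^sup>2 + (S j - T k j) \<le> K j * g k" if "1 \<le> k" for k j
    proof -
      have "(rate_C (c j) (d j) k)\<^sup>2 * rate_rho (c j) (d j) ^ (2 * (k - 1)) \<le> g k"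
        unfolding g_def
        by (intro mult_mono power_mono
C_ge \<rho>_ge rate_C_nonneg rate_rho_nonneg zero_le_power C0)
      from mult_left_mono[OF this K(1)[of j]] K(2)[OF that, of j] show ?thesis by linarith
    qed
    define A where "A j = a j / (1 - \<kappa> j * S j) * (1 + \<alpha>\<^sup>2 * \<sigma>\<^sup>2)" for j
    have A: "A j \<ge> 0" for j
      unfolding A_def using a[of j] \<kappa>S[of j] by (intro mult_nonneg_nonneg) auto
    define K' where "K' = 2 * \<sigma>\<^sup>2 / \<theta> * (\<Sum>j\<in>UNIV. A j * K j)"
    have K': "K' \<ge> 0" unfolding K'_def
      using assms by (intro mult_nonneg_nonneg sum_nonneg A K) auto
    have bound: "\<bar>R k - l\<bar> \<le> K' * g k" if k: "1 \<le> k" for k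
    proof -
      have gap: "\<bar>(a j * (m k j)\<^sup>2 / (1 - 2 * a j * v k j) - ln (1 - 2 * a j * v k j) / 2) - (- ln (1 - \<kappa> j * S j) / 2)\<bar>
          \<le> A j * K j * g k" for j
      proof -
        have "\<bar>(a j * (m k j)\<^sup>2 / (1 - 2 * a j * v k j) - ln (1 - 2 * a j * v k j) / 2) - (- ln (1 - \<kappa> j * S j) / 2)\<bar>
          \<le> a j / (1 - \<kappa> j * S j) * ((m k j)\<^sup>2 + (\<alpha>\<^sup>2 * \<sigma>\<^sup>2 * S j - v k j))"
          unfolding av[symmetric]
          by (rule log_moment_gap[OF a]) (use TS \<kappa>S in \<open>auto simp: v_def av intro!: mult_left_mono\<close>)
        also have "\<dots> \<le> a j / (1 - \<kappa> j * S j) * ((1 + \<alpha>\<^sup>2 * \<sigma>\<^sup>2) * ((m k j)\<^sup>2 + (S j - T k j)))"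
        proof (rule mult_left_mono)
          have "(1 + \<alpha>\<^sup>2 * \<sigma>\<^sup>2) * ((m k j)\<^sup>2 + (S j - T k j))
              = (m k j)\<^sup>2 + (\<alpha>\<^sup>2 * \<sigma>\<^sup>2 * S j - v k j) + ((S j - T k j) + \<alpha>\<^sup>2 * \<sigma>\<^sup>2 * (m k j)\<^sup>2)"
            unfolding v_def by (simp add: algebra_simps)
          moreover have "0 \<le> (S j - T k j) + \<alpha>\<^sup>2 * \<sigma>\<^sup>2 * (m k j)\<^sup>2"
            using TS[of k j] by (intro add_nonneg_nonneg) auto
          ultimately show "(m k j)\<^sup>2 + (\<alpha>\<^sup>2 * \<sigma>\<^sup>2 * S j - v k j) \<le> (1 + \<alpha>\<^sup>2 * \<sigma>\<^sup>2) * ((m k j)\<^sup>2 + (S j - T k j))"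
            by linarith
          show "0 \<le> a j / (1 - \<kappa> j * S j)" using a[of j] \<kappa>S[of j] by simp
        qed
        also have "\<dots> = A j * ((m k j)\<^sup>2 + (S j - T k j))" unfolding A_def by (simp add: mult.assoc)
        also have "\<dots> \<le> A j * (K j * g k)" by (intro mult_left_mono mode k A)
        finally show ?thesis by (simp add: mult.assoc)
      qed
      have "R k - l = 2 * \<sigma>\<^sup>2 / \<theta> * (\<Sum>j\<in>UNIV. (a j * (m k j)\<^sup>2 / (1 - 2 * a j * v k j) - ln (1 - 2 * a j * v k j) / 2)
          - (- ln (1 - \<kappa> j * S j) / 2))"
        unfolding R_def l_def by (simp only: sum_subtractf right_diff_distrib)
      hence "\<bar>R k - l\<bar> = 2 * \<sigma>\<^sup>2 / \<theta> * \<bar>\<Sum>j\<in>UNIV. (a j * (m k j)\<^sup>2 / (1 - 2 * a j * v k j) - ln (1 - 2 * a j * v k j) / 2)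
          - (- ln (1 - \<kappa> j * S j) / 2)\<bar>"
        using assms(12,13) by (simp only: abs_mult) simp
      also have "\<dots> \<le> 2 * \<sigma>\<^sup>2 / \<theta> * (\<Sum>j\<in>UNIV. A j * K j * g k)"
        using assms(12,13) by (intro mult_left_mono order_trans[OF sum_abs] sum_mono gap) auto
      also have "\<dots> = K' * g k" unfolding K'_def by (simp add: sum_distrib_right)
      finally show ?thesis .
    qed
    \<comment> \<open>A ratio strictly above \<open>\<rho>\<close> absorbs the linear growth of \<open>C\<close>, and it is positive even if \<open>\<rho> = 0\<close>.\<close>
    define q where "q = (1 + \<rho>) / 2"
    have q: "\<rho> < q" "0 < q" "q < 1" using \<rho> unfolding q_def by auto
    obtain B where B: "\<And>k. 1 \<le> k \<Longrightarrow> \<bar>C k\<bar> * \<rho> ^ (k - 1) \<le> B * q ^ k"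
      using gmm_C_rate_geometric[OF \<rho>(1) q(1) n] unfolding C_def by blast
    have g_geo: "g k \<le> B\<^sup>2 * q ^ k" if "1 \<le> k" for k
    proof -
      have "g k = (\<bar>C k\<bar> * \<rho> ^ (k - 1))\<^sup>2"
        unfolding g_def by (simp add: power_mult_distrib power_mult[symmetric] mult.commute)
      also have "\<dots> \<le> (B * q ^ k)\<^sup>2" using B[OF that] \<rho> by (intro power_mono) auto
      also have "\<dots> = B\<^sup>2 * q ^ k * q ^ k" by (simp add: power2_eq_square)
      also have "\<dots> \<le> B\<^sup>2 * q ^ k * 1" using q by (intro mult_left_mono power_le_one) auto
      finally show ?thesis by simp
    qed
    have g0: "0 \<le> g k" for k unfolding g_def using \<rho> by simp
    have gG: "g k \<le> (C k)\<^sup>2 * \<rho> ^ (2 * (k - 1)) + (C k) ^ 4 * \<rho> ^ (4 * (k - 1))" for k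
      unfolding g_def using \<rho> by simp
    note res = limsup_linear_convergence[OF rkR bound K' g_geo g0 q(2,3) gG]
    show ?thesis using res \<rho>(2) unfolding rinf_def[symmetric] C_def \<rho>_def by simp
  qed

  have "(\<alpha>, \<beta>, \<gamma>) \<in> feasible_set lam CARD('d) \<theta>" if fin: "\<bar>rinf\<bar> \<noteq> \<infinity>"
  proof -
    \<comment> \<open>All Gaussian factors are at least one, so a bound on their product bounds each of them, and
      the bound holds for every \<open>k\<close> because the partial energies increase.\<close>
    have "rinf < \<infinity>" using fin by (cases rinf) auto
    then obtain b where "limsup rk < ereal b" unfolding rinf_def using ereal_dense2 by blast
    hence ev: "eventually (\<lambda>k. rk k < ereal b) sequentially" by (rule Limsup_lessD)
    define B where "B = exp (b * \<theta> / (2 * \<sigma>\<^sup>2))"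
    have small: "\<kappa> j * T k j \<le> 1 - 1 / B\<^sup>2" if "rk k < ereal b" for j k
    proof -
      let ?G = "\<lambda>j. gaussian_exp_square (a j) (m k j) (v k j)"
      have "ln_ennreal (\<Prod>j\<in>UNIV. ?G j) < ereal (b * \<theta> / (2 * \<sigma>\<^sup>2))"
        using that assms(12,13) unfolding rk
        by (cases "ln_ennreal (\<Prod>j\<in>UNIV. ?G j)") (auto simp: field_simps)
      from ln_ennreal_less_imp_le[OF this] have "(\<Prod>j\<in>UNIV. ?G j) \<le> ennreal B" unfolding B_def .
      moreover have "?G j \<le> (\<Prod>j\<in>UNIV. ?G j)"
        by (rule prod_ge_factor_ennreal) (rule gaussian_exp_square_ge_1[OF a v0])
      ultimately have "?G j \<le> ennreal B" by (rule order_trans[rotated])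
      from gaussian_exp_square_le_imp(1)[OF a v0 this] show ?thesis unfolding v_def av .
    qed
    have B: "B > 0" unfolding B_def by simp
    have T_bound: "T k j \<le> (1 - 1 / B\<^sup>2) / \<kappa> j" for k j
    proof -
      obtain N where N: "\<And>k. N \<le> k \<Longrightarrow> rk k < ereal b" using ev unfolding eventually_sequentially by blast
      have "T k j \<le> T (max k N) j" unfolding T_def by (intro sum_mono2) auto
      also have "\<dots> \<le> (1 - 1 / B\<^sup>2) / \<kappa> j" using small[OF N, of "max k N" j] \<kappa>[of j] by (simp add: field_simps)
      finally show ?thesis .
    qed
    have "summable (\<lambda>i. (h j i)\<^sup>2) \<and> \<kappa> j * (\<Sum>i. (h j i)\<^sup>2) < 1" for j
    proof
      show sm: "summable (\<lambda>i. (h j i)\<^sup>2)"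
        using T_bound[of _ j] unfolding T_def by (intro bounded_imp_summable) auto
      have "(\<Sum>i. (h j i)\<^sup>2) \<le> (1 - 1 / B\<^sup>2) / \<kappa> j"
      proof (rule suminf_le_const[OF sm])
        fix k
        have "(\<Sum>i<k. (h j i)\<^sup>2) \<le> T k j" unfolding T_def by (intro sum_mono2) auto
        thus "(\<Sum>i<k. (h j i)\<^sup>2) \<le> (1 - 1 / B\<^sup>2) / \<kappa> j" using T_bound order_trans by blast
      qed
      hence "\<kappa> j * (\<Sum>i. (h j i)\<^sup>2) \<le> 1 - 1 / B\<^sup>2"
        using \<kappa>[of j] by (simp add: field_simps)
      also have "\<dots> < 1" using B by simp
      finally show "\<kappa> j * (\<Sum>i. (h j i)\<^sup>2) < 1" .
    qed
    thus ?thesis using feas by blast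
  qed
  thus ?thesis
    by (intro conjI iffI impI) (assumption | (drule conv, elim conjE, assumption))+
qed

end
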